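(* Let $D\subset\mathbb{R}^d$ be a domain above the graph of a function satisfying the conditions in the context, and let $w:[0,\infty)\to\mathbb{R}^d$ be continuous with $w_0\in D$. Then there is a unique $x_t$ solving the extended Skorohod problem for $(w,D,n)$, that is, a unique $x\in C([0,\infty),\bar D)$ satisfying $$x_t=w_t+\int_0^tL_s\,ds+L_t,\qquad t\ge0,$$ where $L\in C([0,\infty),\mathbb{R}^d)$ has bounded variation on every $(0,T)$, $T<\infty$, with $|L|_t=\int_0^t1_{(x_s\in\partial D)}\,d|L|_s$ and $L_t=\int_0^tn(x_s)\,d|L|_s$, and $|L|_t$ is the total variation of $L$ on $[0,t]$.
   Context: $d\ge2$, $x=(x^1,\dots,x^d)$, $(\cdot,\cdot)$ is the Euclidean inner product, and $n$ is the inward unit normal vector field on $\partial D$. Conditions on $D$: $D=\{x\in\mathbb{R}^d:x^d>f(x^1,\dots,x^{d-1})\}$ with $f(0,\dots,0)=0$, and there is $0<\alpha<1$ such that $|f(x)|<1-\alpha$ and $n(x)^d>\alpha$ for all $x$ (where $n(x)^d$ is the $d$-th component of $n(x)$). Standing assumptions on $D$: (i) there is $C_0$ such that $(x'-x,n(x))+C_0|x-x'|^2\ge0$ for all $x\in\partial D$, $x'\in\bar D$; (ii) for all $x\in\partial D$, if $k\in\mathbb{R}^d$ and $C\ge0$ satisfy $(x'-x,k)+C|x-x'|^2\ge0$ for all $x'\in\bar D$, then $k=\theta n(x)$ for some $\theta\ge0$. *)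

theory Defs
  imports "HOL-Analysis.Analysis"
begin

text \<open>
  Euclidean space of dimension \<open>d \<ge> 2\<close> is \<open>(real ^ 'm) \<times> real\<close> with \<open>d = CARD('m) + 1\<close>: the
  product inner product and norm are the Euclidean ones, and \<open>snd x\<close> is the last coordinate.
\<close>

definition above_graph :: "(real ^ 'm \<Rightarrow> real) \<Rightarrow> ((real ^ 'm) \<times> real) set" where
  "above_graph f = {x. f (fst x) < snd x}"

text \<open>
  The boundary of \<open>above_graph f\<close> is the graph of \<open>f\<close>, and the inward unit normal at \<open>(a, f a)\<close>
  is \<open>(- \<nabla>f a, 1)\<close> divided by its norm. The existence of the normal at every boundary point
  includes that \<open>f\<close> is differentiable everywhere; no continuity of the gradient is required.
  Off the boundary \<open>n\<close> is arbitrary.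
\<close>

definition inward_unit_normal ::
    "(real ^ 'm \<Rightarrow> real) \<Rightarrow> ((real ^ 'm) \<times> real \<Rightarrow> (real ^ 'm) \<times> real) \<Rightarrow> bool" where
  "inward_unit_normal f n \<longleftrightarrow>
     (\<forall>a. \<exists>g. GDERIV f a :> g \<and> n (a, f a) = sgn (- g, 1))"

text \<open>
  Partitions are increasing finite lists of points of \<open>S\<close>. The empty list is allowed, so the
  variation over the empty set is \<open>0\<close>.
\<close>

definition variation_sums :: "real set \<Rightarrow> (real \<Rightarrow> 'e::real_normed_vector) \<Rightarrow> real set" where
  "variation_sums S L =
     {(\<Sum>i<length ps - 1. norm (L (ps ! Suc i) - L (ps ! i))) | ps. sorted ps \<and> set ps \<subseteq> S}"

definition has_bounded_variation :: "real set \<Rightarrow> (real \<Rightarrow> 'e::real_normed_vector) \<Rightarrow> bool" where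
  "has_bounded_variation S L \<longleftrightarrow> bdd_above (variation_sums S L)"

definition total_variation :: "(real \<Rightarrow> 'e::real_normed_vector) \<Rightarrow> real \<Rightarrow> real" where
  "total_variation L t = Sup (variation_sums {0..t} L)"

text \<open>
  The Stieltjes measure \<open>d|L|\<close>. If \<open>L\<close> is continuous on \<open>[0,\<infinity>)\<close> and of bounded variation on bounded
  intervals, \<open>total_variation L\<close> is continuous, nondecreasing and zero on \<open>(-\<infinity>,0]\<close>, so this is the
  measure that charges \<open>(a,b]\<close> with \<open>|L|\<^sub>b - |L|\<^sub>a\<close>.
\<close>

definition variation_measure :: "(real \<Rightarrow> 'e::real_normed_vector) \<Rightarrow> real measure" where
  "variation_measure L = interval_measure (total_variation L)"

text \<open>
  In the last clause the integral over \<open>[0,t]\<close> is taken over the times at which \<open>x\<close> is on the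
  boundary: \<open>n\<close> is a vector field on the boundary only, and by the clause before it \<open>d|L|\<close> charges
  no other times. Paths are indexed by all of \<open>real\<close>, but only their values on \<open>[0,\<infinity>)\<close> matter.
\<close>

definition extended_skorohod ::
    "(real \<Rightarrow> 'e::euclidean_space) \<Rightarrow> 'e set \<Rightarrow> ('e \<Rightarrow> 'e) \<Rightarrow> (real \<Rightarrow> 'e) \<Rightarrow> bool" where
  "extended_skorohod w D n x \<longleftrightarrow>
     continuous_on {0..} x \<and> (\<forall>t\<ge>0. x t \<in> closure D) \<and>
     (\<exists>L. continuous_on {0..} L \<and>
          (\<forall>T>0. has_bounded_variation {0<..<T} L) \<and>
          (\<forall>t\<ge>0. x t = w t + integral {0..t} L + L t) \<and>
          (\<forall>t\<ge>0. total_variation L t =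
             (LINT s:{0..t}|variation_measure L. indicator (frontier D) (x s))) \<and>
          (\<forall>t\<ge>0. L t =
             (LINT s:{s\<in>{0..t}. x s \<in> frontier D}|variation_measure L. n (x s))))"

end

theory Submission
  imports Defs "HOL-Complex_Analysis.Great_Picard"
begin

text \<open>
  The two standing conditions say that \<open>D\<close> has a uniform exterior sphere at each boundary point and that
  proximal normals are multiples of \<open>n\<close>. They make \<open>n\<close> continuous on the boundary
  (\<open>continuous_normal\<close>) and nearest point projections normal (\<open>projection_exists\<close>). The graph
  supplies a direction \<open>e\<close>, the vertical one, that satisfies \<open>n \<bullet> e \<ge> \<alpha>\<close> on the boundary and in which
  the boundary is bounded above; the theorem holds for every domain with these properties, the locale
  \<open>reflecting_domain\<close>.

  Measures are kept out of the argument as long as possible. The integral conditions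
  \<open>d|L| = 1\<^bsub>x \<in> \<partial>D\<^esub> d|L|\<close> and \<open>dL = n(x) d|L|\<close> are equivalent to a statement about increments: \<open>L\<close>
  moves by \<open>v\<close> times the increment of a nondecreasing clock \<open>A\<close>, up to a relative error \<open>\<epsilon>\<close>, on every
  interval on which the visited normals are within \<open>\<epsilon>\<close> of \<open>v\<close> (\<open>pushed_along\<close>). Conversely \<open>n\<close> has
  length one, so the clock is recovered as the total variation (\<open>total_variation_pushed\<close>), and the
  integral of \<open>n(x)\<close> has the same increments as \<open>L\<close> (\<open>stieltjes_pushed_along\<close>, \<open>pushed_along_unique\<close>).
  The total variation of a continuous function is right continuous, so it generates a Stieltjes
  measure (\<open>total_variation_right_continuous\<close>).

  Uniqueness: for two solutions the difference \<open>z = x - y\<close> has bounded variation since \<open>w\<close> cancels, and by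
  the exterior sphere condition a push of \<open>x\<close> raises \<open>|z|\<^sup>2\<close> by at most \<open>2 C0 |z|\<^sup>2 d|L|\<close>. The drift
  difference solves a linear equation driven by \<open>z\<close>, so the sum of the two squares grows by at most its
  maximum times the increment of a right continuous clock (\<open>distance_growth\<close>); it therefore cannot
  leave \<open>0\<close>.

  Existence: follow the input with time step \<open>h\<close> and project to the nearest point of the closure after
  every step. Since pushes take place on the boundary, whose height is bounded, and never push down,
  their total height and hence their total length is bounded uniformly in \<open>h\<close> (\<open>scheme_bound\<close>).
  Given this, the growth estimate for \<open>|L - L\<^sub>i|\<^sup>2\<close> from the exterior sphere condition yields a modulus of
  continuity (\<open>scheme_push_modulus\<close>). A subsequence of the step functions converges locally uniformly,
  and the increment formulation passes to the limit (\<open>pushed_along_limit\<close>).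
\<close>

section \<open>From local to global increments\<close>

text \<open>
  Cutting \<open>[a, b]\<close> into small pieces turns an estimate of increments that holds up to a factor \<open>\<epsilon>\<close> on
  short intervals into an exact one on \<open>[a, b]\<close>, because the errors add up to \<open>\<epsilon> (k b - k a)\<close>. It
  stands in for the product rule of Stieltjes calculus.
\<close>

lemma increments_le_of_local:
  fixes g h k :: "real \<Rightarrow> real"
  assumes ab: "a \<le> b"
    and loc: "\<And>\<epsilon>. \<epsilon> > 0 \<Longrightarrow> \<exists>\<delta>>0. \<forall>s t. a \<le> s \<longrightarrow> s \<le> t \<longrightarrow> t \<le> b \<longrightarrow> t - s < \<delta> \<longrightarrow>
               g t - g s \<le> (h t - h s) + \<epsilon> * (k t - k s)"
  shows "g b - g a \<le> h b - h a"
proof -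
  have le: "g b - g a \<le> h b - h a + \<epsilon> * (k b - k a)" if \<epsilon>: "\<epsilon> > 0" for \<epsilon>
  proof -
    obtain \<delta> where \<delta>: "\<delta> > 0" and step: "\<And>s t. a \<le> s \<Longrightarrow> s \<le> t \<Longrightarrow> t \<le> b \<Longrightarrow> t - s < \<delta> \<Longrightarrow>
               g t - g s \<le> (h t - h s) + \<epsilon> * (k t - k s)"
      using loc[OF \<epsilon>] by blast
    obtain N :: nat where N: "(b - a) / \<delta> < real N" using reals_Archimedean2 by blast
    moreover have "0 \<le> (b - a) / \<delta>" using ab \<delta> by simp
    ultimately have N0: "real N > 0" by linarith
    define p where "p i = a + real i * ((b - a) / N)" for i :: nat
    have ps: "p (Suc i) = p i + (b - a) / N" for i
      unfolding p_def of_nat_Suc distrib_right by simp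
    have d0: "(b - a) / N \<ge> 0" using ab N0 by simp
    have d1: "(b - a) / N < \<delta>" using N N0 \<delta> by (simp add: field_simps)
    have "i \<le> N \<Longrightarrow> g (p i) - g a \<le> h (p i) - h a + \<epsilon> * (k (p i) - k a)" for i
    proof (induction i)
      case 0
      then show ?case by (simp add: p_def)
    next
      case (Suc i)
      have "real (Suc i) * ((b - a) / N) \<le> real N * ((b - a) / N)"
        using Suc.prems d0 by (intro mult_right_mono) auto
      then have "p (Suc i) \<le> b" using N0 by (simp add: p_def)
      moreover have "a \<le> p i" using mult_nonneg_nonneg[OF _ d0, of "real i"] by (simp add: p_def)
      ultimately have "g (p (Suc i)) - g (p i) \<le>
          (h (p (Suc i)) - h (p i)) + \<epsilon> * (k (p (Suc i)) - k (p i))"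
        using d0 d1 by (intro step) (auto simp: ps)
      with Suc show ?case by (simp add: algebra_simps)
    qed
    from this[of N] show ?thesis using N0 by (simp add: p_def)
  qed
  show ?thesis
  proof (rule ccontr)
    assume "\<not> ?thesis"
    then have pos: "(g b - g a) - (h b - h a) > 0" (is "?d > 0") by simp
    \<comment> \<open>\<open>q\<close> makes the choice \<open>\<epsilon> = d / q\<close> contradictory, where \<open>d\<close> is the positive difference.\<close>
    define q where "q = \<bar>k b - k a\<bar> + 1"
    have q: "q > 0" "k b - k a < q" by (auto simp: q_def)
    have "?d \<le> ?d / q * (k b - k a)" using le[of "?d / q"] pos q by simp
    also have "\<dots> < ?d / q * q" using q pos by (intro mult_strict_left_mono) auto
    finally show False using q by simp
  qed
qed

lemma constant_of_local:
  fixes G :: "real \<Rightarrow> 'e::real_normed_vector" and k :: "real \<Rightarrow> real"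
  assumes "a \<le> b"
    and loc: "\<And>\<epsilon>. \<epsilon> > 0 \<Longrightarrow> \<exists>\<delta>>0. \<forall>s t. a \<le> s \<longrightarrow> s \<le> t \<longrightarrow> t \<le> b \<longrightarrow> t - s < \<delta> \<longrightarrow>
               norm (G t - G s) \<le> \<epsilon> * (k t - k s)"
  shows "G b = G a"
proof -
  have "norm (G b - G a) - norm (G a - G a) \<le> 0 - 0"
  proof (rule increments_le_of_local[OF assms(1), where h = "\<lambda>_. 0" and k = k])
    fix \<epsilon> :: real assume "\<epsilon> > 0"
    then obtain \<delta> where "\<delta> > 0" and *: "\<And>s t. a \<le> s \<Longrightarrow> s \<le> t \<Longrightarrow> t \<le> b \<Longrightarrow> t - s < \<delta> \<Longrightarrow>
               norm (G t - G s) \<le> \<epsilon> * (k t - k s)"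
      using loc by blast
    have "norm (G t - G a) - norm (G s - G a) \<le> norm (G t - G s)" for s t
      using norm_triangle_ineq2[of "G t - G a" "G s - G a"] by simp
    then show "\<exists>\<delta>>0. \<forall>s t. a \<le> s \<longrightarrow> s \<le> t \<longrightarrow> t \<le> b \<longrightarrow> t - s < \<delta> \<longrightarrow>
        norm (G t - G a) - norm (G s - G a) \<le> 0 - 0 + \<epsilon> * (k t - k s)"
      using \<open>\<delta> > 0\<close> * by (intro exI[of _ \<delta>]) (smt (verit))
  qed
  then show ?thesis by simp
qed

section \<open>The reflecting domain\<close>

text \<open>
  Three properties of the domain carry the proof: the exterior sphere condition, the fact that
  proximal normals are multiples of \<open>n\<close>, and one direction \<open>e\<close> that makes an acute angle with all
  normals, bounded away from a right angle, and in which the boundary is bounded above. Above a graph,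
  \<open>e\<close> is the vertical direction.
\<close>

locale reflecting_domain =
  fixes D :: "'e::euclidean_space set" and n :: "'e \<Rightarrow> 'e" and C0 R \<alpha> :: real and e :: 'e
  assumes unit_normal: "\<And>x. x \<in> frontier D \<Longrightarrow> norm (n x) = 1"
    and C0_nonneg: "C0 \<ge> 0"
    and exterior_sphere: "\<And>x x'. x \<in> frontier D \<Longrightarrow> x' \<in> closure D \<Longrightarrow>
           (x' - x) \<bullet> n x + C0 * (norm (x - x'))\<^sup>2 \<ge> 0"
    and proximal_normal: "\<And>x k C. x \<in> frontier D \<Longrightarrow> C \<ge> 0 \<Longrightarrow>
           (\<forall>x'\<in>closure D. (x' - x) \<bullet> k + C * (norm (x - x'))\<^sup>2 \<ge> 0) \<Longrightarrow> \<exists>\<theta>\<ge>0. k = \<theta> *\<^sub>R n x"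
    and norm_e: "norm e = 1"
    and alpha_pos: "\<alpha> > 0"
    and normal_e: "\<And>x. x \<in> frontier D \<Longrightarrow> \<alpha> \<le> n x \<bullet> e"
    and frontier_e: "\<And>x. x \<in> frontier D \<Longrightarrow> x \<bullet> e \<le> R"
begin

text \<open>
  The inequality of the exterior sphere condition is closed in the pair (point, normal) and singles
  out the unit normal, so the graph of the unit normal is closed; it takes values in a compact
  sphere, hence it is continuous.
\<close>

lemma continuous_normal: "continuous_on (frontier D) n"
proof (rule continuous_from_closed_graph)
  show "compact (sphere 0 1 :: 'e set)" by simp
  show "n \<in> frontier D \<rightarrow> sphere 0 1" using unit_normal by auto
  let ?G = "(frontier D \<times> sphere 0 1) \<inter>
      (\<Inter>x'\<in>closure D. {p. 0 \<le> (x' - fst p) \<bullet> snd p + C0 * (norm (fst p - x'))\<^sup>2})"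
  have "(\<lambda>x. (x, n x)) ` frontier D = ?G"
  proof safe
    fix x k assume x: "x \<in> frontier D" and k: "k \<in> sphere 0 1"
      and all: "(x, k) \<in> (\<Inter>x'\<in>closure D. {p. 0 \<le> (x' - fst p) \<bullet> snd p + C0 * (norm (fst p - x'))\<^sup>2})"
    then have "\<exists>\<theta>\<ge>0. k = \<theta> *\<^sub>R n x" by (intro proximal_normal[OF x C0_nonneg]) auto
    then obtain \<theta> where "\<theta> \<ge> 0" "k = \<theta> *\<^sub>R n x" by blast
    then have "k = n x" using k unit_normal[OF x] by auto
    then show "(x, k) \<in> (\<lambda>x. (x, n x)) ` frontier D" using x by auto
  qed (use unit_normal exterior_sphere in auto)
  moreover have "closed ?G"
    by (intro closed_Int closed_Times closed_INT ballI closed_Collect_le continuous_intros) auto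
  ultimately show "closed ((\<lambda>x. (x, n x)) ` frontier D)" by simp
qed

text \<open>
  The displacement \<open>p - y\<close> from a point to its nearest point in the closure satisfies the exterior
  sphere inequality with constant \<open>1/2\<close>, so it is a nonnegative multiple of the normal at \<open>p\<close>.
\<close>

lemma projection_exists:
  assumes "D \<noteq> {}"
  obtains p where "p \<in> closure D" "\<And>x. x \<in> closure D \<Longrightarrow> norm (p - y) \<le> norm (x - y)"
    "p - y = norm (p - y) *\<^sub>R n p" "p \<noteq> y \<Longrightarrow> p \<in> frontier D"
proof -
  obtain p where p: "p \<in> closure D" and "\<And>x. x \<in> closure D \<Longrightarrow> dist y p \<le> dist y x"
    using distance_attains_inf[of "closure D" y] assms by auto
  then have near: "norm (p - y) \<le> norm (x - y)" if "x \<in> closure D" for x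
    using that by (simp add: dist_norm norm_minus_commute)
  have fr: "p \<in> frontier D" if ne: "p \<noteq> y"
  proof (rule ccontr)
    assume "p \<notin> frontier D"
    then have "p \<in> interior D" using p by (auto simp: frontier_def)
    then obtain r where r: "r > 0" "ball p r \<subseteq> D" by (auto simp: mem_interior)
    define c where "c = min (1/2) (r / (2 * norm (p - y)))"
    have np: "norm (p - y) > 0" using ne by simp
    have c: "c > 0" "c < 1" using np r by (auto simp: c_def)
    let ?q = "p - c *\<^sub>R (p - y)"
    have "dist p ?q = c * norm (p - y)" using c by (simp add: dist_norm)
    also have "\<dots> \<le> r / (2 * norm (p - y)) * norm (p - y)"
      by (intro mult_right_mono) (auto simp: c_def)
    also have "\<dots> < r" using np r by simp
    finally have "?q \<in> ball p r" by (simp only: mem_ball)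
    then have "?q \<in> closure D" using r closure_subset[of D] by blast
    from near[OF this] have "norm (p - y) \<le> norm ((1 - c) *\<^sub>R (p - y))" by (simp add: algebra_simps)
    then show False using c np by simp
  qed
  have eq: "p - y = norm (p - y) *\<^sub>R n p"
  proof (cases "p = y")
    case False
    have "\<forall>x'\<in>closure D. (x' - p) \<bullet> (p - y) + (1/2) * (norm (p - x'))\<^sup>2 \<ge> 0"
    proof
      fix x' assume "x' \<in> closure D"
      then have "(norm (p - y))\<^sup>2 \<le> (norm (x' - y))\<^sup>2" using near by (intro power_mono) auto
      then show "(x' - p) \<bullet> (p - y) + (1/2) * (norm (p - x'))\<^sup>2 \<ge> 0"
        by (simp add: power2_norm_eq_inner algebra_simps inner_commute)
    qed
    then obtain \<theta> where \<theta>: "\<theta> \<ge> 0" "p - y = \<theta> *\<^sub>R n p"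
      using proximal_normal[OF fr[OF False], of "1/2" "p - y"] by auto
    then have "norm (p - y) = \<theta>" using unit_normal[OF fr[OF False]] by simp
    then show ?thesis using \<theta>(2) by simp
  qed simp
  show thesis by (rule that[OF p near eq fr])
qed

lemma normal_inner_le:
  assumes "x \<in> frontier D" "x' \<in> closure D"
  shows "(x - x') \<bullet> n x \<le> C0 * (norm (x - x'))\<^sup>2"
  using exterior_sphere[OF assms] by (simp add: inner_diff_left)

end

section \<open>Pushing along the normal\<close>

text \<open>
  This is the relation \<open>dL = 1\<^bsub>x \<in> B\<^esub> n(x) dA\<close> without integrals: on an interval on which the normals
  at the visited boundary points stay within \<open>\<epsilon>\<close> of a vector \<open>v\<close>, the increment of \<open>L\<close> is \<open>v\<close> times
  that of \<open>A\<close> up to a relative error \<open>\<epsilon>\<close>. If \<open>x\<close> does not visit \<open>B\<close> then every \<open>v\<close> is admitted with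
  \<open>\<epsilon> = 0\<close>, which forces \<open>A\<close> and \<open>L\<close> to stand still. The relation survives uniform limits.
\<close>

definition pushed_along ::
    "'e::euclidean_space set \<Rightarrow> ('e \<Rightarrow> 'e) \<Rightarrow> (real \<Rightarrow> 'e) \<Rightarrow> (real \<Rightarrow> 'e) \<Rightarrow> (real \<Rightarrow> real) \<Rightarrow> bool"
  where
  "pushed_along B n x L A \<longleftrightarrow>
     (\<forall>s t v \<epsilon>. 0 \<le> s \<longrightarrow> s \<le> t \<longrightarrow> 0 \<le> \<epsilon> \<longrightarrow> (\<forall>r\<in>{s..t}. x r \<in> B \<longrightarrow> norm (n (x r) - v) \<le> \<epsilon>) \<longrightarrow>
        norm (L t - L s - (A t - A s) *\<^sub>R v) \<le> \<epsilon> * (A t - A s))"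

lemma pushed_alongD:
  assumes "pushed_along B n x L A" "0 \<le> s" "s \<le> t" "0 \<le> \<epsilon>"
    "\<And>r. s \<le> r \<Longrightarrow> r \<le> t \<Longrightarrow> x r \<in> B \<Longrightarrow> norm (n (x r) - v) \<le> \<epsilon>"
  shows "norm (L t - L s - (A t - A s) *\<^sub>R v) \<le> \<epsilon> * (A t - A s)"
  using assms unfolding pushed_along_def by auto

lemma pushed_along_idle:
  fixes B :: "'e::euclidean_space set"
  assumes push: "pushed_along B n x L A" and st: "0 \<le> s" "s \<le> t"
    and off: "\<And>r. s \<le> r \<Longrightarrow> r \<le> t \<Longrightarrow> x r \<notin> B"
  shows "A t = A s" "L t = L s"
proof -
  obtain b :: 'e where b: "b \<in> Basis" by (meson nonempty_Basis ex_in_conv)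
  have 0: "norm (L t - L s - (A t - A s) *\<^sub>R 0) \<le> 0 * (A t - A s)"
    by (rule pushed_alongD[OF push st]) (use off in auto)
  then show "L t = L s" by simp
  have "norm (L t - L s - (A t - A s) *\<^sub>R b) \<le> 0 * (A t - A s)"
    by (rule pushed_alongD[OF push st]) (use off in auto)
  with 0 show "A t = A s" using b by auto
qed

lemma (in reflecting_domain) pushed_along_norm_le:
  assumes "pushed_along (frontier D) n x L A" "0 \<le> s" "s \<le> t"
  shows "norm (L t - L s) \<le> A t - A s"
  using pushed_alongD[OF assms, of 1 0] unit_normal by auto

lemma (in reflecting_domain) pushed_along_mono:
  assumes "pushed_along (frontier D) n x L A" "0 \<le> s" "s \<le> t"
  shows "A s \<le> A t"
  using pushed_along_norm_le[OF assms] norm_ge_zero[of "L t - L s"] by linarith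

text \<open>
  On a compact time interval the boundary visits form a compact set, on which the normal varies
  uniformly continuously in time.
\<close>

lemma (in reflecting_domain) normal_uniformly_continuous:
  assumes "continuous_on {a..b} x" and "\<epsilon> > 0"
  obtains \<delta> :: real where "\<delta> > 0"
    "\<And>r r'. r \<in> {a..b} \<Longrightarrow> r' \<in> {a..b} \<Longrightarrow> x r \<in> frontier D \<Longrightarrow> x r' \<in> frontier D \<Longrightarrow>
        \<bar>r - r'\<bar> < \<delta> \<Longrightarrow> norm (n (x r) - n (x r')) \<le> \<epsilon>"
proof -
  let ?Z = "{a..b} \<inter> x -` frontier D"
  have "closed ?Z"
    by (rule continuous_closed_preimage[OF assms(1)]) auto
  moreover have "?Z \<subseteq> {a..b}" by auto
  ultimately have "compact ?Z" by (metis closed_Int_compact compact_Icc inf.absorb1)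
  moreover have "continuous_on ?Z (\<lambda>r. n (x r))"
    by (rule continuous_on_compose2[OF continuous_normal])
      (auto intro: continuous_on_subset[OF assms(1)])
  ultimately have "uniformly_continuous_on ?Z (\<lambda>r. n (x r))"
    by (rule compact_uniformly_continuous[rotated])
  then obtain \<delta> where "\<delta> > 0" "\<And>r r'. r \<in> ?Z \<Longrightarrow> r' \<in> ?Z \<Longrightarrow> dist r' r < \<delta> \<Longrightarrow> dist (n (x r')) (n (x r)) < \<epsilon>"
    using assms(2) unfolding uniformly_continuous_on_def by metis
  then show thesis
    by (intro that[of \<delta>]) (auto simp: dist_norm norm_minus_commute abs_minus_commute intro!: less_imp_le)
qed

text \<open>
  On a short interval the push is therefore a nearly fixed normal, taken at any visited boundary
  point, times the increment of the clock.
\<close>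

lemma (in reflecting_domain) pushed_along_local:
  assumes cont: "continuous_on {a..b} x" and a0: "0 \<le> a"
    and push: "pushed_along (frontier D) n x L A" and eps: "\<epsilon> > 0"
  obtains \<delta> :: real where "\<delta> > 0"
    "\<And>s t. a \<le> s \<Longrightarrow> s \<le> t \<Longrightarrow> t \<le> b \<Longrightarrow> t - s < \<delta> \<Longrightarrow>
       A t = A s \<and> L t = L s \<or>
       (\<exists>r\<in>{s..t}. x r \<in> frontier D \<and> norm (L t - L s - (A t - A s) *\<^sub>R n (x r)) \<le> \<epsilon> * (A t - A s))"
proof -
  obtain \<delta> where \<delta>: "\<delta> > 0"
    "\<And>r r'. r \<in> {a..b} \<Longrightarrow> r' \<in> {a..b} \<Longrightarrow> x r \<in> frontier D \<Longrightarrow> x r' \<in> frontier D \<Longrightarrow>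
        \<bar>r - r'\<bar> < \<delta> \<Longrightarrow> norm (n (x r) - n (x r')) \<le> \<epsilon>"
    using normal_uniformly_continuous[OF cont eps] by metis
  show thesis
  proof (rule that[OF \<delta>(1)])
    fix s t assume st: "a \<le> s" "s \<le> t" "t \<le> b" "t - s < \<delta>"
    show "A t = A s \<and> L t = L s \<or>
       (\<exists>r\<in>{s..t}. x r \<in> frontier D \<and> norm (L t - L s - (A t - A s) *\<^sub>R n (x r)) \<le> \<epsilon> * (A t - A s))"
    proof (cases "\<exists>r\<in>{s..t}. x r \<in> frontier D")
      case True
      then obtain r where r: "r \<in> {s..t}" "x r \<in> frontier D" by blast
      have "norm (L t - L s - (A t - A s) *\<^sub>R n (x r)) \<le> \<epsilon> * (A t - A s)"
        by (rule pushed_alongD[OF push]) (use st r a0 eps in \<open>auto intro!: \<delta>(2)\<close>)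
      with r show ?thesis by blast
    next
      case False
      then show ?thesis using pushed_along_idle[OF push, of s t] st a0 by auto
    qed
  qed
qed

section \<open>Uniqueness\<close>

text \<open>
  The clock \<open>A\<close> is any function along which \<open>L\<close> is pushed; that it is the total variation of \<open>L\<close> is a
  consequence.
\<close>

definition push_solution ::
    "(real \<Rightarrow> 'e::euclidean_space) \<Rightarrow> 'e set \<Rightarrow> ('e \<Rightarrow> 'e) \<Rightarrow>
     (real \<Rightarrow> 'e) \<Rightarrow> (real \<Rightarrow> 'e) \<Rightarrow> (real \<Rightarrow> real) \<Rightarrow> bool" where
  "push_solution w D n x L A \<longleftrightarrow>
     continuous_on {0..} x \<and> (\<forall>t\<ge>0. x t \<in> closure D) \<and> continuous_on {0..} L \<and>
     (\<forall>t\<ge>0. x t = w t + integral {0..t} L + L t) \<and> L 0 = 0 \<and> A 0 = 0 \<and>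
     pushed_along (frontier D) n x L A"

context reflecting_domain
begin

text \<open>
  When \<open>x\<close> is pushed at a boundary point \<open>x r\<close>, the exterior sphere condition seen from that point
  bounds the component of the push away from \<open>y r\<close>; moving from the time \<open>r\<close> to the end \<open>t\<close> of the
  short interval costs an error \<open>\<epsilon>\<close>.
\<close>

lemma push_inner_le:
  assumes x: "continuous_on {a..b} x" and y: "continuous_on {a..b} y" and a0: "0 \<le> a"
    and push: "pushed_along (frontier D) n x L A"
    and yD: "\<And>r. r \<in> {a..b} \<Longrightarrow> y r \<in> closure D"
    and M: "\<And>r. r \<in> {a..b} \<Longrightarrow> norm (x r - y r) \<le> M" "0 \<le> M" and eps: "\<epsilon> > 0"
  obtains \<delta> :: real where "\<delta> > 0"
    "\<And>s t. a \<le> s \<Longrightarrow> s \<le> t \<Longrightarrow> t \<le> b \<Longrightarrow> t - s < \<delta> \<Longrightarrow>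
        (x t - y t) \<bullet> (L t - L s) \<le> (C0 * M\<^sup>2 + \<epsilon>) * (A t - A s)"
proof -
  define \<eta> where "\<eta> = \<epsilon> / (1 + M)"
  have "\<eta> * (1 + M) = \<epsilon>" using M(2) by (simp add: \<eta>_def)
  then have "\<eta> + M * \<eta> = \<epsilon>" by (simp add: algebra_simps)
  moreover have "\<eta> > 0" using eps M(2) by (simp add: \<eta>_def)
  ultimately have \<eta>: "\<eta> > 0" "\<eta> + M * \<eta> = \<epsilon>" by auto
  obtain \<delta>1 where \<delta>1: "\<delta>1 > 0"
    "\<And>s t. a \<le> s \<Longrightarrow> s \<le> t \<Longrightarrow> t \<le> b \<Longrightarrow> t - s < \<delta>1 \<Longrightarrow>
       A t = A s \<and> L t = L s \<or>
       (\<exists>r\<in>{s..t}. x r \<in> frontier D \<and> norm (L t - L s - (A t - A s) *\<^sub>R n (x r)) \<le> \<eta> * (A t - A s))"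
    using pushed_along_local[OF x a0 push \<eta>(1)] by metis
  have "uniformly_continuous_on {a..b} (\<lambda>r. x r - y r)"
    by (intro compact_uniformly_continuous continuous_intros x y compact_Icc)
  then obtain \<delta>2 where \<delta>2: "\<delta>2 > 0" "\<And>r t. r \<in> {a..b} \<Longrightarrow> t \<in> {a..b} \<Longrightarrow> dist t r < \<delta>2 \<Longrightarrow>
      dist (x t - y t) (x r - y r) < \<eta>"
    using \<eta>(1) unfolding uniformly_continuous_on_def by metis
  show thesis
  proof (rule that[of "min \<delta>1 \<delta>2"])
    fix s t assume st: "a \<le> s" "s \<le> t" "t \<le> b" "t - s < min \<delta>1 \<delta>2"
    consider "A t = A s" "L t = L s" | r where "r \<in> {s..t}" "x r \<in> frontier D"
      "norm (L t - L s - (A t - A s) *\<^sub>R n (x r)) \<le> \<eta> * (A t - A s)"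
      using \<delta>1(2)[of s t] st by auto
    then show "(x t - y t) \<bullet> (L t - L s) \<le> (C0 * M\<^sup>2 + \<epsilon>) * (A t - A s)"
    proof cases
      case 2
      define q where "q = L t - L s - (A t - A s) *\<^sub>R n (x r)"
      have dA: "A t - A s \<ge> 0" using pushed_along_mono[OF push, of s t] st a0 by simp
      have "(x t - y t) \<bullet> n (x r) = (x r - y r) \<bullet> n (x r) + ((x t - y t) - (x r - y r)) \<bullet> n (x r)"
        by (simp add: inner_diff_left)
      also have "(x r - y r) \<bullet> n (x r) \<le> C0 * (norm (x r - y r))\<^sup>2"
        using 2 st yD by (intro normal_inner_le) auto
      also have "\<dots> \<le> C0 * M\<^sup>2"
        using M(1)[of r] 2(1) st C0_nonneg by (intro mult_left_mono power_mono) auto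
      also have "((x t - y t) - (x r - y r)) \<bullet> n (x r) \<le> norm ((x t - y t) - (x r - y r)) * norm (n (x r))"
        by (rule norm_cauchy_schwarz)
      also have "\<dots> \<le> \<eta>"
        using \<delta>2(2)[of r t] 2 st unit_normal by (auto simp: dist_norm intro!: less_imp_le)
      finally have 1: "(x t - y t) \<bullet> n (x r) \<le> C0 * M\<^sup>2 + \<eta>" by simp
      have "(x t - y t) \<bullet> q \<le> norm (x t - y t) * norm q" by (rule norm_cauchy_schwarz)
      also have "\<dots> \<le> M * (\<eta> * (A t - A s))"
        using 2(3) M(1)[of t] st M(2) by (intro mult_mono) (auto simp: q_def)
      finally have 2: "(x t - y t) \<bullet> q \<le> M * (\<eta> * (A t - A s))" .
      have "L t - L s = (A t - A s) *\<^sub>R n (x r) + q" by (simp add: q_def)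
      then have "(x t - y t) \<bullet> (L t - L s) = (A t - A s) * ((x t - y t) \<bullet> n (x r)) + (x t - y t) \<bullet> q"
        by (simp add: inner_add_right)
      also have "\<dots> \<le> (A t - A s) * (C0 * M\<^sup>2 + \<eta>) + M * (\<eta> * (A t - A s))"
        using 1 2 dA by (intro add_mono mult_left_mono) auto
      also have "\<dots> = (C0 * M\<^sup>2 + \<epsilon>) * (A t - A s)" by (simp add: \<eta>(2)[symmetric] algebra_simps)
      finally show ?thesis .
    qed simp
  qed (use \<delta>1 \<delta>2 in auto)
qed

lemma norm_power2_increment_le:
  fixes a b :: "'e"
  shows "(norm b)\<^sup>2 - (norm a)\<^sup>2 \<le> 2 * (b \<bullet> (b - a))"
proof -
  have "0 \<le> (b - a) \<bullet> (b - a)" by simp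
  then show ?thesis by (simp add: power2_norm_eq_inner algebra_simps inner_commute)
qed

text \<open>
  For two solutions, \<open>|x - y|\<^sup>2\<close> plus the square of the difference of the drifts grows by at most its
  maximum times the increment of a clock. Each factor \<open>z\<^sub>t\<close> is taken at the end of its interval, where
  the quadratic term \<open>- |dz|\<^sup>2\<close> of the discrete product rule has the favourable sign.
\<close>

lemma distance_growth:
  assumes x: "push_solution w D n x L A" and y: "push_solution w D n y L' A'"
    and ab: "0 \<le> a" "a \<le> b"
    and M: "\<And>r. r \<in> {a..b} \<Longrightarrow>
      (norm (x r - y r))\<^sup>2 + (norm (integral {0..r} L - integral {0..r} L'))\<^sup>2 \<le> m"
  shows "((norm (x b - y b))\<^sup>2 + (norm (integral {0..b} L - integral {0..b} L'))\<^sup>2) -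
         ((norm (x a - y a))\<^sup>2 + (norm (integral {0..a} L - integral {0..a} L'))\<^sup>2)
       \<le> m * (8 * b + 2 * C0 * (A b + A' b)) - m * (8 * a + 2 * C0 * (A a + A' a))"
proof -
  define z where "z r = x r - y r" for r
  define p where "p r = integral {0..r} L - integral {0..r} L'" for r
  define u where "u r = L r - L' r" for r
  have mM: "m \<ge> 0" using M[of a] ab by (smt (verit) atLeastAtMost_iff zero_le_power2)
  define M' where "M' = sqrt m"
  have M': "M' \<ge> 0" "M'\<^sup>2 = m" using mM by (auto simp: M'_def)
  have bz: "norm (z r) \<le> M'" and bp: "norm (p r) \<le> M'" if "r \<in> {a..b}" for r
    using M[OF that] by (auto simp: M'_def z_def p_def intro!: real_le_rsqrt) 
      (smt (verit) zero_le_power2)+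
  have contL: "continuous_on {s..t} L" "continuous_on {s..t} L'" "continuous_on {s..t} x"
    "continuous_on {s..t} y" if "0 \<le> s" for s t
    using x y that unfolding push_solution_def
    by (auto intro: continuous_on_subset)
  have zu: "z r = p r + u r" if "r \<ge> 0" for r
    using x y that by (auto simp: push_solution_def z_def p_def u_def)
  have dp: "norm (p t - p s) \<le> (2 * M') * (t - s)" if st: "a \<le> s" "s \<le> t" "t \<le> b" for s t
  proof -
    have split: "integral {0..s} K + integral {s..t} K = integral {0..t} K"
      if "continuous_on {0..t} K" for K :: "real \<Rightarrow> 'e"
      using st ab that by (intro Henstock_Kurzweil_Integration.integral_combine
          integrable_continuous_interval) auto
    have "p t - p s = integral {s..t} L - integral {s..t} L'"
      unfolding p_def split[OF contL(1)[OF order_refl], symmetric]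
        split[OF contL(2)[OF order_refl], symmetric] by simp
    also have "\<dots> = integral {s..t} u"
      using st ab contL unfolding u_def
      by (intro Henstock_Kurzweil_Integration.integral_diff[symmetric] integrable_continuous_interval) auto
    also have "norm \<dots> \<le> (2 * M') * (t - s)"
    proof (rule integral_bound)
      show "continuous_on {s..t} u" unfolding u_def using st ab contL by (intro continuous_intros) auto
      show "norm (u r) \<le> 2 * M'" if "r \<in> {s..t}" for r
        using zu[of r] bz[of r] bp[of r] that st ab norm_triangle_ineq4[of "z r" "p r"] by auto
    qed (use st in auto)
    finally show ?thesis .
  qed
  have "((norm (z b))\<^sup>2 + (norm (p b))\<^sup>2) - ((norm (z a))\<^sup>2 + (norm (p a))\<^sup>2)
       \<le> m * (8 * b + 2 * C0 * (A b + A' b)) - m * (8 * a + 2 * C0 * (A a + A' a))"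
  proof (rule increments_le_of_local[OF ab(2), where k = "\<lambda>r. A r + A' r"])
    fix \<epsilon> :: real assume "\<epsilon> > 0"
    then have eps: "\<epsilon> / 2 > 0" by simp
    have bzx: "norm (x r - y r) \<le> M'" "norm (y r - x r) \<le> M'" if "r \<in> {a..b}" for r
      using bz[OF that] by (auto simp: z_def norm_minus_commute)
    have cl: "y r \<in> closure D" "x r \<in> closure D" if "r \<in> {a..b}" for r
      using x y that ab by (auto simp: push_solution_def)
    have px: "pushed_along (frontier D) n x L A" and py: "pushed_along (frontier D) n y L' A'"
      using x y by (auto simp: push_solution_def)
    obtain \<delta>1 where d1: "\<delta>1 > 0" "\<And>s t. a \<le> s \<Longrightarrow> s \<le> t \<Longrightarrow> t \<le> b \<Longrightarrow> t - s < \<delta>1 \<Longrightarrow>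
        (x t - y t) \<bullet> (L t - L s) \<le> (C0 * M'\<^sup>2 + \<epsilon> / 2) * (A t - A s)"
      using push_inner_le[OF contL(3,4)[OF ab(1)] ab(1) px cl(1) bzx(1) M'(1) eps] by metis
    obtain \<delta>2 where d2: "\<delta>2 > 0" "\<And>s t. a \<le> s \<Longrightarrow> s \<le> t \<Longrightarrow> t \<le> b \<Longrightarrow> t - s < \<delta>2 \<Longrightarrow>
        (y t - x t) \<bullet> (L' t - L' s) \<le> (C0 * M'\<^sup>2 + \<epsilon> / 2) * (A' t - A' s)"
      using push_inner_le[OF contL(4,3)[OF ab(1)] ab(1) py cl(2) bzx(2) M'(1) eps] by metis
    show "\<exists>\<delta>>0. \<forall>s t. a \<le> s \<longrightarrow> s \<le> t \<longrightarrow> t \<le> b \<longrightarrow> t - s < \<delta> \<longrightarrow>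
       (norm (z t))\<^sup>2 + (norm (p t))\<^sup>2 - ((norm (z s))\<^sup>2 + (norm (p s))\<^sup>2)
        \<le> m * (8 * t + 2 * C0 * (A t + A' t)) - m * (8 * s + 2 * C0 * (A s + A' s)) +
          \<epsilon> * (A t + A' t - (A s + A' s))"
    proof (intro exI[of _ "min \<delta>1 \<delta>2"] conjI allI impI)
      fix s t assume st: "a \<le> s" "s \<le> t" "t \<le> b" "t - s < min \<delta>1 \<delta>2"
      have small: "v \<bullet> (p t - p s) \<le> 2 * m * (t - s)" if "norm v \<le> M'" for v
      proof -
        have "v \<bullet> (p t - p s) \<le> norm v * norm (p t - p s)" by (rule norm_cauchy_schwarz)
        also have "\<dots> \<le> M' * ((2 * M') * (t - s))"
          using that dp[of s t] st M'(1) by (intro mult_mono) auto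
        also have "\<dots> = 2 * m * (t - s)" by (simp add: M'(2)[symmetric] power2_eq_square)
        finally show ?thesis .
      qed
      have "z t - z s = (p t - p s) + (L t - L s) - (L' t - L' s)"
        using zu[of t] zu[of s] st ab by (simp add: u_def)
      then have "z t \<bullet> (z t - z s) = z t \<bullet> (p t - p s) + z t \<bullet> (L t - L s) + (- z t) \<bullet> (L' t - L' s)"
        by (simp add: inner_diff_right inner_add_right)
      also have "\<dots> \<le> 2 * m * (t - s) + (C0 * m + \<epsilon> / 2) * (A t - A s) + (C0 * m + \<epsilon> / 2) * (A' t - A' s)"
        using small[OF bz[of t]] d1(2)[of s t] d2(2)[of s t] st by (intro add_mono) (auto simp: z_def M'(2))
      finally have 1: "z t \<bullet> (z t - z s) \<le>
          2 * m * (t - s) + (C0 * m + \<epsilon> / 2) * (A t - A s) + (C0 * m + \<epsilon> / 2) * (A' t - A' s)" .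
      have 2: "p t \<bullet> (p t - p s) \<le> 2 * m * (t - s)" using small[OF bp[of t]] st by simp
      have "(norm (z t))\<^sup>2 + (norm (p t))\<^sup>2 - ((norm (z s))\<^sup>2 + (norm (p s))\<^sup>2)
          \<le> 2 * (z t \<bullet> (z t - z s)) + 2 * (p t \<bullet> (p t - p s))"
        using norm_power2_increment_le[of "z t" "z s"] norm_power2_increment_le[of "p t" "p s"] by simp
      also have "\<dots> \<le> 2 * (2 * m * (t - s) + (C0 * m + \<epsilon> / 2) * (A t - A s) + (C0 * m + \<epsilon> / 2) * (A' t - A' s))
          + 2 * (2 * m * (t - s))"
        using 1 2 by simp
      also have "\<dots> = m * (8 * t + 2 * C0 * (A t + A' t)) - m * (8 * s + 2 * C0 * (A s + A' s)) +
          \<epsilon> * (A t + A' t - (A s + A' s))"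
        by (simp add: field_simps)
      finally show "(norm (z t))\<^sup>2 + (norm (p t))\<^sup>2 - ((norm (z s))\<^sup>2 + (norm (p s))\<^sup>2)
        \<le> m * (8 * t + 2 * C0 * (A t + A' t)) - m * (8 * s + 2 * C0 * (A s + A' s)) +
          \<epsilon> * (A t + A' t - (A s + A' s))" .
    qed (use d1 d2 in auto)
  qed
  then show ?thesis by (simp add: z_def p_def)
qed

text \<open>
  At the first time \<open>\<tau>\<close> after which the solutions differ, the clock advances by less than \<open>1/2\<close> on a
  short interval \<open>[\<tau>, b]\<close>, so the maximum \<open>m\<close> of the distance there satisfies \<open>m \<le> m / 2\<close>.
\<close>

lemma push_solution_unique:
  assumes x: "push_solution w D n x L A" and y: "push_solution w D n y L' A'"
    and A: "\<And>t. t \<ge> 0 \<Longrightarrow> continuous (at_right t) A"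
    and A': "\<And>t. t \<ge> 0 \<Longrightarrow> continuous (at_right t) A'"
    and t: "t \<ge> 0"
  shows "x t = y t"
proof -
  define g where "g r = (norm (x r - y r))\<^sup>2 + (norm (integral {0..r} L - integral {0..r} L'))\<^sup>2" for r
  define h where "h r = 8 * r + 2 * C0 * (A r + A' r)" for r
  have g_alt: "g r = (norm (x r - y r))\<^sup>2 + (norm (x r - y r - (L r - L' r)))\<^sup>2" if "r \<ge> 0" for r
    using x y that by (simp add: g_def push_solution_def)
  have "continuous_on {0..} (\<lambda>r. (norm (x r - y r))\<^sup>2 + (norm (x r - y r - (L r - L' r)))\<^sup>2)"
    using x y by (intro continuous_intros) (auto simp: push_solution_def)
  then have g_cont: "continuous_on {0..} g"
    by (rule continuous_on_eq) (simp add: g_alt)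
  have g0: "g 0 = 0" using x y by (simp add: g_alt push_solution_def)
  have g_nonneg: "g r \<ge> 0" for r by (simp add: g_def)
  have "g t = 0"
  proof (rule ccontr)
    assume "g t \<noteq> 0"
    define S where "S = {r. r \<ge> 0 \<and> g r \<noteq> 0}"
    have S: "S \<noteq> {}" "bdd_below S" using \<open>g t \<noteq> 0\<close> t by (auto simp: S_def intro!: bdd_belowI)
    define \<tau> where "\<tau> = Inf S"
    have \<tau>0: "\<tau> \<ge> 0" unfolding \<tau>_def by (rule cInf_greatest[OF S(1)]) (auto simp: S_def)
    have before: "g r = 0" if "0 \<le> r" "r < \<tau>" for r
      using that S(2) unfolding \<tau>_def S_def by (metis (mono_tags, lifting) cInf_lower leD mem_Collect_eq)
    have g\<tau>: "g \<tau> = 0"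
    proof (cases "\<tau> = 0")
      case False
      then have "\<tau> > 0" using \<tau>0 by simp
      have "(g \<longlongrightarrow> g \<tau>) (at_left \<tau>)"
      proof -
        have "(g \<longlongrightarrow> g \<tau>) (at \<tau> within {0..})" using g_cont \<tau>0 by (auto simp: continuous_on_def)
        moreover have "at \<tau> within {0..} = at \<tau>"
          using \<open>\<tau> > 0\<close> by (intro at_within_interior) auto
        ultimately show ?thesis by (simp add: filterlim_at_split)
      qed
      moreover have "(g \<longlongrightarrow> 0) (at_left \<tau>)"
      proof (rule tendsto_eventually)
        show "\<forall>\<^sub>F r in at_left \<tau>. g r = 0"
          unfolding eventually_at_left[OF \<open>\<tau> > 0\<close>]
          using before \<open>\<tau> > 0\<close> by (intro exI[of _ 0]) auto
      qed
      ultimately show ?thesis using tendsto_unique trivial_limit_at_left_real by blast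
    qed (use g0 in simp)
    have "(A \<longlongrightarrow> A \<tau>) (at_right \<tau>)" "(A' \<longlongrightarrow> A' \<tau>) (at_right \<tau>)"
      using A[OF \<tau>0] A'[OF \<tau>0] by (auto simp: continuous_within)
    then have "(h \<longlongrightarrow> h \<tau>) (at_right \<tau>)" unfolding h_def by (intro tendsto_intros)
    then have "\<forall>\<^sub>F r in at_right \<tau>. h r < h \<tau> + 1/2"
      by (rule order_tendstoD) simp
    then obtain c where c: "c > \<tau>" "\<And>r. \<tau> < r \<Longrightarrow> r < c \<Longrightarrow> h r < h \<tau> + 1/2"
      unfolding eventually_at_right_field by blast
    obtain b where b: "b \<in> S" "b < c"
      using cInf_lessD[OF S(1), of c] c(1) \<tau>_def by auto
    have \<tau>b: "\<tau> \<le> b" unfolding \<tau>_def by (rule cInf_lower[OF b(1) S(2)])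
    obtain q where q: "q \<in> {\<tau>..b}" "\<And>r. r \<in> {\<tau>..b} \<Longrightarrow> g r \<le> g q"
      using continuous_attains_sup[of "{\<tau>..b}" g] \<tau>b \<tau>0 continuous_on_subset[OF g_cont, of "{\<tau>..b}"]
      by auto
    have "g q = 0"
    proof (cases "q = \<tau>")
      case False
      have "g q - g \<tau> \<le> g q * h q - g q * h \<tau>"
        unfolding g_def h_def
        by (rule distance_growth[OF x y]) (use \<tau>0 q in \<open>auto simp: g_def[symmetric]\<close>)
      also have "\<dots> = g q * (h q - h \<tau>)" by (simp add: algebra_simps)
      also have "\<dots> \<le> g q * (1/2)"
        using c(2)[of q] False q(1) b(2) g_nonneg by (intro mult_left_mono) auto
      finally show ?thesis using g\<tau> g_nonneg[of q] by simp
    qed (simp add: g\<tau>)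
    then have "g b \<le> 0" using q(2)[of b] \<tau>b by simp
    with b(1) g_nonneg[of b] show False by (simp add: S_def)
  qed
  then show ?thesis by (simp add: g_def add_nonneg_eq_0_iff)
qed

end

section \<open>The projection scheme\<close>

context reflecting_domain
begin

text \<open>
  Implicit Euler scheme with step \<open>h\<close>: \<open>J\<close> accumulates the drift, and the position
  \<open>w + J + L\<close> is moved back to the closure of \<open>D\<close> by nearest point projection; \<open>A\<close> is the total length
  of the displacements. The last clause holds because the previous position competes with the
  nearest point.
\<close>

definition projection_scheme ::
    "(real \<Rightarrow> 'e) \<Rightarrow> real \<Rightarrow> (nat \<Rightarrow> 'e) \<Rightarrow> (nat \<Rightarrow> 'e) \<Rightarrow> (nat \<Rightarrow> real) \<Rightarrow> bool" where
  "projection_scheme w h J L A \<longleftrightarrow> J 0 = 0 \<and> L 0 = 0 \<and> A 0 = 0 \<and>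
     (\<forall>k. w (real k * h) + J k + L k \<in> closure D) \<and>
     (\<forall>k. J (Suc k) = J k + h *\<^sub>R L k) \<and>
     (\<forall>k. A k \<le> A (Suc k)) \<and>
     (\<forall>k. L (Suc k) = L k + (A (Suc k) - A k) *\<^sub>R n (w (real (Suc k) * h) + J (Suc k) + L (Suc k))) \<and>
     (\<forall>k. A (Suc k) \<noteq> A k \<longrightarrow> w (real (Suc k) * h) + J (Suc k) + L (Suc k) \<in> frontier D) \<and>
     (\<forall>k. A (Suc k) - A k \<le> norm (w (real (Suc k) * h) - w (real k * h) + h *\<^sub>R L k))"

lemma projection_scheme_exists:
  assumes w0: "w 0 \<in> closure D"
  obtains J L A where "projection_scheme w h J L A"
proof -
  define P where "P k s = (case s of (J, L, A :: real) \<Rightarrow>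
      w (real k * h) + J + L \<in> closure D \<and> (k = 0 \<longrightarrow> J = 0 \<and> L = 0 \<and> A = 0))" for k and s :: "'e \<times> 'e \<times> real"
  define Q where "Q k s s' = (case (s, s') of ((J, L, A :: real), (J', L', A')) \<Rightarrow>
      J' = J + h *\<^sub>R L \<and> A \<le> A' \<and>
      L' = L + (A' - A) *\<^sub>R n (w (real (Suc k) * h) + J' + L') \<and>
      (A' \<noteq> A \<longrightarrow> w (real (Suc k) * h) + J' + L' \<in> frontier D) \<and>
      A' - A \<le> norm (w (real (Suc k) * h) - w (real k * h) + h *\<^sub>R L))" for k and s s' :: "'e \<times> 'e \<times> real"
  have "\<exists>S. \<forall>k. P k (S k) \<and> Q k (S k) (S (Suc k))"
  proof (rule dependent_nat_choice)
    show "\<exists>s. P 0 s" using w0 by (intro exI[of _ "(0, 0, 0)"]) (simp add: P_def)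
    fix s k assume "P k s"
    obtain J L A where s: "s = (J, L, A)" by (cases s)
    define y where "y = w (real (Suc k) * h) + (J + h *\<^sub>R L) + L"
    have ne: "D \<noteq> {}" using w0 by auto
    obtain p where p: "p \<in> closure D" "\<And>x. x \<in> closure D \<Longrightarrow> norm (p - y) \<le> norm (x - y)"
      "p - y = norm (p - y) *\<^sub>R n p" "p \<noteq> y \<Longrightarrow> p \<in> frontier D"
      using projection_exists[OF ne, of y] by metis
    have pos: "w (real (Suc k) * h) + (J + h *\<^sub>R L) + (L + (p - y)) = p" by (simp add: y_def)
    have "norm (p - y) \<le> norm (w (real k * h) + J + L - y)"
      using p(2) \<open>P k s\<close> by (simp add: P_def s)
    also have "\<dots> = norm (w (real (Suc k) * h) - w (real k * h) + h *\<^sub>R L)"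
      using norm_minus_cancel[of "w (real k * h) + J + L - y"] by (simp add: y_def algebra_simps)
    finally have "norm (p - y) \<le> norm (w (real (Suc k) * h) - w (real k * h) + h *\<^sub>R L)" .
    then have "P (Suc k) (J + h *\<^sub>R L, L + (p - y), A + norm (p - y)) \<and>
               Q k s (J + h *\<^sub>R L, L + (p - y), A + norm (p - y))"
      unfolding P_def Q_def s prod.case pos using p(1,3,4) by auto
    then show "\<exists>s'. P (Suc k) s' \<and> Q k s s'" by blast
  qed
  then obtain S where S: "\<And>k. P k (S k)" "\<And>k. Q k (S k) (S (Suc k))" by blast
  have "projection_scheme w h (\<lambda>k. fst (S k)) (\<lambda>k. fst (snd (S k))) (\<lambda>k. snd (snd (S k)))"
    unfolding projection_scheme_def
    using S(1)[unfolded P_def case_prod_beta] S(1)[of 0, unfolded P_def case_prod_beta]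
      S(2)[unfolded Q_def case_prod_beta fst_conv snd_conv]
    by (intro conjI allI; blast)
  then show thesis by (rule that)
qed

context
  fixes w h J L A
  assumes scheme: "projection_scheme w h J L A" and h: "h > 0"
begin

lemma scheme_push_step:
  "L (Suc k) - L k = (A (Suc k) - A k) *\<^sub>R n (w (real (Suc k) * h) + J (Suc k) + L (Suc k))"
  using scheme unfolding projection_scheme_def by (metis add_diff_cancel_left')

lemma scheme_push_frontier:
  "A (Suc k) \<noteq> A k \<Longrightarrow> w (real (Suc k) * h) + J (Suc k) + L (Suc k) \<in> frontier D"
  using scheme unfolding projection_scheme_def by blast

lemma scheme_A_mono: "i \<le> m \<Longrightarrow> A i \<le> A m"
  using scheme lift_Suc_mono_le[of A i m] by (auto simp: projection_scheme_def)

lemma scheme_push_nonneg: "0 \<le> L k \<bullet> e"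
  and scheme_push_e: "i \<le> m \<Longrightarrow> \<alpha> * (A m - A i) \<le> (L m - L i) \<bullet> e"
proof -
  have step: "\<alpha> * (A (Suc k) - A k) \<le> (L (Suc k) - L k) \<bullet> e" for k
  proof (cases "A (Suc k) = A k")
    case False
    let ?x = "w (real (Suc k) * h) + J (Suc k) + L (Suc k)"
    have "(L (Suc k) - L k) \<bullet> e = (A (Suc k) - A k) * (n ?x \<bullet> e)"
      by (subst scheme_push_step) simp
    moreover have "(A (Suc k) - A k) * \<alpha> \<le> (A (Suc k) - A k) * (n ?x \<bullet> e)"
      using normal_e[OF scheme_push_frontier[OF False]] scheme_A_mono[of k "Suc k"] by (intro mult_left_mono) auto
    ultimately show ?thesis by (simp add: mult.commute)
  qed (use scheme_push_step[of k] in simp)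
  show inc: "\<alpha> * (A m - A i) \<le> (L m - L i) \<bullet> e" if "i \<le> m" for i m
    using that
  proof (induction m rule: dec_induct)
    case (step m)
    then show ?case using \<open>\<And>k. \<alpha> * (A (Suc k) - A k) \<le> (L (Suc k) - L k) \<bullet> e\<close>[of m]
      by (simp add: algebra_simps inner_diff_left)
  qed simp
  have "0 \<le> \<alpha> * (A k - A 0)" using scheme_A_mono[of 0 k] alpha_pos by simp
  also have "\<dots> \<le> L k \<bullet> e" using inc[of 0 k] scheme by (simp add: projection_scheme_def)
  finally show "0 \<le> L k \<bullet> e" .
qed

text \<open>
  A push takes place on the boundary, whose height in the direction \<open>e\<close> is at most \<open>R\<close>. As the drift
  only helps, the height of \<open>L\<close> after a push is at most \<open>R + W\<close>; the length \<open>A\<close> is controlled by that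
  height.
\<close>

lemma scheme_bound:
  assumes W: "\<And>t. 0 \<le> t \<Longrightarrow> t \<le> T \<Longrightarrow> norm (w t) \<le> W" and k: "real k * h \<le> T"
    and V: "V = max 0 (R + W) / \<alpha>"
  shows "A k \<le> V" "norm (L k) \<le> V"
proof -
  have Je: "0 \<le> J j \<bullet> e" for j
  proof (induction j)
    case (Suc j)
    then show ?case using scheme scheme_push_nonneg[of j] h
      by (simp add: projection_scheme_def inner_add_left)
  qed (use scheme in \<open>simp add: projection_scheme_def\<close>)
  have "real j * h \<le> T \<Longrightarrow> L j \<bullet> e \<le> max 0 (R + W)" for j
  proof (induction j)
    case (Suc j)
    have jT: "real j * h \<le> T" using Suc.prems h by (simp add: algebra_simps)
    show ?case
    proof (cases "A (Suc j) = A j")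
      case True
      then have "L (Suc j) = L j" using scheme_push_step[of j] by simp
      then show ?thesis using Suc.IH[OF jT] by simp
    next
      case False
      let ?t = "real (Suc j) * h"
      have "(w ?t + J (Suc j) + L (Suc j)) \<bullet> e \<le> R"
        by (intro frontier_e scheme_push_frontier False)
      moreover have "- (w ?t \<bullet> e) \<le> W"
        using Cauchy_Schwarz_ineq2[of "w ?t" e] W[of ?t] Suc.prems h norm_e by auto
      ultimately show ?thesis using Je[of "Suc j"] by (simp add: inner_add_left)
    qed
  qed (use scheme in \<open>simp add: projection_scheme_def\<close>)
  from this[OF k] have "\<alpha> * (A k - A 0) \<le> max 0 (R + W)"
    using scheme_push_e[of 0 k] scheme by (simp add: projection_scheme_def)
  then show Ak: "A k \<le> V"
    using scheme alpha_pos by (simp add: V projection_scheme_def field_simps)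
  have "norm (L j) \<le> A j" for j
  proof (induction j)
    case (Suc j)
    let ?x = "w (real (Suc j) * h) + J (Suc j) + L (Suc j)"
    have "norm (L (Suc j)) \<le> norm (L j) + norm (L (Suc j) - L j)"
      using norm_triangle_ineq[of "L j" "L (Suc j) - L j"] by simp
    also have "norm (L (Suc j) - L j) = A (Suc j) - A j"
      using scheme_A_mono[of j "Suc j"] unit_normal[OF scheme_push_frontier[of j]]
      unfolding scheme_push_step by (cases "A (Suc j) = A j") (auto simp del: of_nat_Suc)
    finally show ?case using Suc by simp
  qed (use scheme in \<open>simp add: projection_scheme_def\<close>)
  then show "norm (L k) \<le> V" using Ak order_trans by blast
qed

lemma scheme_drift_increment:
  assumes "i \<le> m" and V: "\<And>k. i \<le> k \<Longrightarrow> k < m \<Longrightarrow> norm (L k - v) \<le> V"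
  shows "norm (J m - J i - (real (m - i) * h) *\<^sub>R v) \<le> V * (real (m - i) * h)"
  using assms
proof (induction m rule: dec_induct)
  case (step m)
  have "J (Suc m) - J i - (real (Suc m - i) * h) *\<^sub>R v
      = (J m - J i - (real (m - i) * h) *\<^sub>R v) + h *\<^sub>R (L m - v)"
    using scheme step.hyps by (simp add: projection_scheme_def Suc_diff_le algebra_simps)
  also have "norm \<dots> \<le> norm (J m - J i - (real (m - i) * h) *\<^sub>R v) + norm (h *\<^sub>R (L m - v))"
    by (rule norm_triangle_ineq)
  also have "\<dots> \<le> V * (real (m - i) * h) + h * V"
    using step.IH step.prems step.hyps h by (intro add_mono) auto
  also have "\<dots> = V * (real (Suc m - i) * h)" using step.hyps by (simp add: Suc_diff_le algebra_simps)
  finally show ?case .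
qed simp

lemma scheme_push_increment:
  assumes "i \<le> m" and \<epsilon>: "\<epsilon> \<ge> 0"
    and near: "\<And>k. i < k \<Longrightarrow> k \<le> m \<Longrightarrow> w (real k * h) + J k + L k \<in> frontier D \<Longrightarrow>
      norm (n (w (real k * h) + J k + L k) - v) \<le> \<epsilon>"
  shows "norm (L m - L i - (A m - A i) *\<^sub>R v) \<le> \<epsilon> * (A m - A i)"
  using assms(1) near
proof (induction m rule: dec_induct)
  case (step m)
  let ?x = "w (real (Suc m) * h) + J (Suc m) + L (Suc m)"
  have le: "norm ((A (Suc m) - A m) *\<^sub>R (n ?x - v)) \<le> \<epsilon> * (A (Suc m) - A m)"
  proof (cases "A (Suc m) = A m")
    case False
    then have "norm (n ?x - v) \<le> \<epsilon>" using step.prems[of "Suc m"] step.hyps scheme_push_frontier[OF False]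
      by (simp del: of_nat_Suc)
    then have "(A (Suc m) - A m) * norm (n ?x - v) \<le> (A (Suc m) - A m) * \<epsilon>"
      using scheme_A_mono[of m "Suc m"] by (intro mult_left_mono) auto
    then show ?thesis using scheme_A_mono[of m "Suc m"] by (simp add: mult.commute)
  qed simp
  have "L (Suc m) - L i - (A (Suc m) - A i) *\<^sub>R v
      = (L m - L i - (A m - A i) *\<^sub>R v) + (L (Suc m) - L m - (A (Suc m) - A m) *\<^sub>R v)"
    by (simp add: algebra_simps)
  also have "L (Suc m) - L m - (A (Suc m) - A m) *\<^sub>R v = (A (Suc m) - A m) *\<^sub>R (n ?x - v)"
    by (simp only: scheme_push_step scaleR_diff_right)
  also have "norm ((L m - L i - (A m - A i) *\<^sub>R v) + (A (Suc m) - A m) *\<^sub>R (n ?x - v))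
      \<le> norm (L m - L i - (A m - A i) *\<^sub>R v) + norm ((A (Suc m) - A m) *\<^sub>R (n ?x - v))"
    by (rule norm_triangle_ineq)
  also have "\<dots> \<le> \<epsilon> * (A m - A i) + \<epsilon> * (A (Suc m) - A m)"
    using step le by (intro add_mono) auto
  finally show ?case by (simp add: algebra_simps)
qed simp

text \<open>
  The modulus of continuity of the push. Each displacement is normal at the new position, where the
  exterior sphere condition seen from the position at time \<open>i\<close> bounds the growth of \<open>|L - L\<^sub>i|\<^sup>2\<close> by
  that quantity itself plus the oscillation \<open>\<eta>\<close> of the input, both times the increment of \<open>A\<close>. This is
  an implicit discrete Gronwall inequality; the small increments of \<open>A\<close> make it explicit, through
  \<open>1 / (1 - u) \<le> exp (2 u)\<close> for \<open>u \<le> 1/2\<close>.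
\<close>

lemma scheme_push_modulus:
  assumes "i \<le> m" and \<eta>: "\<eta> \<ge> 0"
    and osc: "\<And>k. i \<le> k \<Longrightarrow> k \<le> m \<Longrightarrow>
      norm ((w (real k * h) + J k) - (w (real i * h) + J i)) \<le> \<eta>"
    and small: "\<And>k. i \<le> k \<Longrightarrow> k < m \<Longrightarrow> 8 * C0 * (A (Suc k) - A k) \<le> 1"
  shows "(norm (L m - L i))\<^sup>2 \<le> (4 * C0 * \<eta>\<^sup>2 + 2 * \<eta>) * (A m - A i) * exp (8 * C0 * (A m - A i))"
  using assms(1) osc small
proof (induction m rule: dec_induct)
  case (step m)
  define b where "b = 4 * C0 * \<eta>\<^sup>2 + 2 * \<eta>"
  define E where "E k = exp (8 * C0 * (A k - A i))" for k
  define x where "x k = w (real k * h) + J k + L k" for k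
  define dA where "dA = A (Suc m) - A m"
  have b: "b \<ge> 0" using \<eta> C0_nonneg by (simp add: b_def)
  have dA: "dA \<ge> 0" using scheme_A_mono[of m "Suc m"] by (simp add: dA_def)
  have IH: "(norm (L m - L i))\<^sup>2 \<le> b * (A m - A i) * E m"
    using step by (simp add: b_def E_def)
  have u: "4 * C0 * dA \<le> 1/2" using step.prems(2)[of m] step.hyps by (simp add: dA_def)
  have u0: "0 \<le> 4 * C0 * dA" using dA C0_nonneg by simp
  have L: "L (Suc m) - L m = dA *\<^sub>R n (x (Suc m))"
    and fr: "dA \<noteq> 0 \<Longrightarrow> x (Suc m) \<in> frontier D"
    using scheme_push_step[of m] scheme_push_frontier[of m] unfolding x_def dA_def by auto
  have key: "(1 - 4 * C0 * dA) * (norm (L (Suc m) - L i))\<^sup>2 \<le> (norm (L m - L i))\<^sup>2 + b * dA"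
  proof (cases "dA = 0")
    case False
    define d where "d = (w (real (Suc m) * h) + J (Suc m)) - (w (real i * h) + J i)"
    have d: "norm d \<le> \<eta>" using step.prems(1)[of "Suc m"] step.hyps by (simp add: d_def)
    let ?z = "x (Suc m) - x i"
    have Lz: "L (Suc m) - L i = ?z - d" by (simp add: x_def d_def)
    have "norm ?z \<le> norm d + norm (L (Suc m) - L i)"
      using Lz norm_triangle_ineq[of d "L (Suc m) - L i"] by simp
    also have "\<dots> \<le> \<eta> + norm (L (Suc m) - L i)" using d by simp
    finally have "(norm ?z)\<^sup>2 \<le> (\<eta> + norm (L (Suc m) - L i))\<^sup>2" by (intro power_mono) auto
    also have "\<dots> \<le> 2 * \<eta>\<^sup>2 + 2 * (norm (L (Suc m) - L i))\<^sup>2"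
      using zero_le_power2[of "\<eta> - norm (L (Suc m) - L i)"] by (simp add: power2_eq_square algebra_simps)
    finally have z2: "(norm ?z)\<^sup>2 \<le> 2 * \<eta>\<^sup>2 + 2 * (norm (L (Suc m) - L i))\<^sup>2" .
    have "?z \<bullet> n (x (Suc m)) \<le> C0 * (norm ?z)\<^sup>2"
      using scheme by (intro normal_inner_le fr[OF False]) (auto simp: projection_scheme_def x_def)
    also have "\<dots> \<le> C0 * (2 * \<eta>\<^sup>2 + 2 * (norm (L (Suc m) - L i))\<^sup>2)"
      using z2 C0_nonneg by (rule mult_left_mono)
    finally have 1: "?z \<bullet> n (x (Suc m)) \<le> C0 * (2 * \<eta>\<^sup>2 + 2 * (norm (L (Suc m) - L i))\<^sup>2)" .
    have "- (d \<bullet> n (x (Suc m))) \<le> \<eta>"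
      using Cauchy_Schwarz_ineq2[of d "n (x (Suc m))"] d unit_normal[OF fr[OF False]] by simp
    with 1 have "(L (Suc m) - L i) \<bullet> n (x (Suc m)) \<le>
        C0 * (2 * \<eta>\<^sup>2 + 2 * (norm (L (Suc m) - L i))\<^sup>2) + \<eta>"
      by (simp add: Lz inner_diff_left)
    then have "dA * ((L (Suc m) - L i) \<bullet> n (x (Suc m))) \<le>
        dA * (C0 * (2 * \<eta>\<^sup>2 + 2 * (norm (L (Suc m) - L i))\<^sup>2) + \<eta>)"
      using dA by (rule mult_left_mono)
    moreover have "(norm (L (Suc m) - L i))\<^sup>2 - (norm (L m - L i))\<^sup>2 \<le>
        2 * (dA * ((L (Suc m) - L i) \<bullet> n (x (Suc m))))"
      using norm_power2_increment_le[of "L (Suc m) - L i" "L m - L i"] L by simp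
    ultimately show ?thesis by (simp add: b_def algebra_simps)
  qed (use L in simp)
  have "(1 - 4 * C0 * dA) * (norm (L (Suc m) - L i))\<^sup>2 \<le> b * (A m - A i) * E m + b * dA"
    using key IH by linarith
  also have "\<dots> \<le> b * (A m - A i) * E m + b * dA * E m"
    using b dA scheme_A_mono[OF step.hyps(1)] C0_nonneg
    by (intro add_left_mono mult_right_mono[of 1 "E m" "b * dA", simplified mult_1 mult.commute[of "E m"]])
      (auto simp: E_def)
  also have "\<dots> = b * (A (Suc m) - A i) * E m" by (simp add: dA_def algebra_simps)
  finally have 1: "(1 - 4 * C0 * dA) * (norm (L (Suc m) - L i))\<^sup>2 \<le> b * (A (Suc m) - A i) * E m" .
  have "1 \<le> (1 - 4 * C0 * dA) * (1 + 2 * (4 * C0 * dA))"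
  proof -
    have "0 \<le> (4 * C0 * dA) * (1 - 2 * (4 * C0 * dA))" by (rule mult_nonneg_nonneg[OF u0]) (use u in simp)
    then show ?thesis by (simp add: algebra_simps)
  qed
  also have "\<dots> \<le> (1 - 4 * C0 * dA) * exp (8 * C0 * dA)"
    using u exp_ge_add_one_self[of "8 * C0 * dA"] by (intro mult_left_mono) (simp_all add: mult.assoc)
  finally have 2: "1 \<le> (1 - 4 * C0 * dA) * exp (8 * C0 * dA)" .
  have "(norm (L (Suc m) - L i))\<^sup>2 \<le>
      ((1 - 4 * C0 * dA) * exp (8 * C0 * dA)) * (norm (L (Suc m) - L i))\<^sup>2"
    using mult_right_mono[OF 2, of "(norm (L (Suc m) - L i))\<^sup>2"] by simp
  also have "\<dots> = exp (8 * C0 * dA) * ((1 - 4 * C0 * dA) * (norm (L (Suc m) - L i))\<^sup>2)" by simp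
  also have "\<dots> \<le> exp (8 * C0 * dA) * (b * (A (Suc m) - A i) * E m)"
    using 1 by (intro mult_left_mono) auto
  also have "exp (8 * C0 * dA) * (b * (A (Suc m) - A i) * E m) = b * (A (Suc m) - A i) * E (Suc m)"
    by (simp add: E_def dA_def exp_add[symmetric] algebra_simps)
  finally show ?case by (simp add: b_def E_def)
qed simp

text \<open>
  The bound on \<open>\<rho>\<close> lets the drift contribute at most \<open>\<eta> / 2\<close> to the oscillation of the input, and
  \<open>8 C0 \<eta> \<le> 1\<close> makes each step of \<open>A\<close>, which is at most \<open>\<eta>\<close>, small enough for the Gronwall
  inequality.
\<close>

lemma scheme_modulus:
  assumes im: "i \<le> m" and mT: "real m * h \<le> T"
    and V: "V > 0" "\<And>k. real k * h \<le> T \<Longrightarrow> A k \<le> V" "\<And>k. real k * h \<le> T \<Longrightarrow> norm (L k) \<le> V"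
    and \<eta>: "0 < \<eta>" "\<eta> \<le> 1" "8 * C0 * \<eta> \<le> 1"
    and \<rho>: "\<rho> \<le> \<eta> / (2 * V)" "h < \<rho>" "real (m - i) * h < \<rho>"
    and w: "\<And>r r'. 0 \<le> r \<Longrightarrow> r \<le> T \<Longrightarrow> 0 \<le> r' \<Longrightarrow> r' \<le> T \<Longrightarrow> \<bar>r - r'\<bar> < \<rho> \<Longrightarrow> norm (w r - w r') \<le> \<eta> / 2"
  shows "norm (J m - J i) \<le> \<eta>"
    and "(norm (L m - L i))\<^sup>2 \<le> (4 * C0 + 2) * V * exp (8 * C0 * V) * \<eta>"
    and "A m - A i \<le> norm (L m - L i) / \<alpha>"
proof -
  have kT: "real k * h \<le> T" if "k \<le> m" for k
  proof -
    have "real k * h \<le> real m * h" using that h by (intro mult_right_mono) auto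
    with mT show ?thesis by linarith
  qed
  have J: "norm (J k - J i) \<le> \<eta> / 2" if k: "i \<le> k" "k \<le> m" for k
  proof -
    have "norm (J k - J i) \<le> V * (real (k - i) * h)"
      using scheme_drift_increment[OF k(1), of 0 V] k kT V(3) by simp
    also have "\<dots> \<le> V * (\<eta> / (2 * V))"
    proof (rule mult_left_mono)
      have "real (k - i) * h \<le> real (m - i) * h" using k h by (intro mult_right_mono) auto
      then show "real (k - i) * h \<le> \<eta> / (2 * V)" using \<rho> by linarith
    qed (use V in simp)
    finally show ?thesis using V(1) by simp
  qed
  from J[OF im] show "norm (J m - J i) \<le> \<eta>" using \<eta> by simp
  have dw: "norm (w (real k * h) - w (real i * h)) \<le> \<eta> / 2" if k: "i \<le> k" "k \<le> m" for k
  proof (rule w)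
    have "\<bar>real k * h - real i * h\<bar> = real (k - i) * h"
      using k h by (simp add: of_nat_diff left_diff_distrib mult_right_mono)
    also have "\<dots> \<le> real (m - i) * h" using k h by (intro mult_right_mono) auto
    finally show "\<bar>real k * h - real i * h\<bar> < \<rho>" using \<rho> by linarith
  qed (use k kT im h in auto)
  have "(norm (L m - L i))\<^sup>2 \<le> (4 * C0 * \<eta>\<^sup>2 + 2 * \<eta>) * (A m - A i) * exp (8 * C0 * (A m - A i))"
  proof (rule scheme_push_modulus[OF im])
    fix k assume k: "i \<le> k" "k \<le> m"
    have "norm ((w (real k * h) + J k) - (w (real i * h) + J i)) \<le>
        norm (w (real k * h) - w (real i * h)) + norm (J k - J i)"
      by (rule norm_diff_triangle_ineq)
    then show "norm ((w (real k * h) + J k) - (w (real i * h) + J i)) \<le> \<eta>"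
      using dw[OF k] J[OF k] by simp
  next
    fix k assume k: "i \<le> k" "k < m"
    have "A (Suc k) - A k \<le> norm (w (real (Suc k) * h) - w (real k * h) + h *\<^sub>R L k)"
      using scheme unfolding projection_scheme_def by blast
    also have "\<dots> \<le> norm (w (real (Suc k) * h) - w (real k * h)) + h * norm (L k)"
      using norm_triangle_ineq[of "w (real (Suc k) * h) - w (real k * h)" "h *\<^sub>R L k"] h by simp
    also have "\<dots> \<le> \<eta> / 2 + \<eta> / (2 * V) * V"
    proof (rule add_mono)
      have "\<bar>real (Suc k) * h - real k * h\<bar> = h" using h by (simp add: algebra_simps)
      then show "norm (w (real (Suc k) * h) - w (real k * h)) \<le> \<eta> / 2"
        using h k kT[of k] kT[of "Suc k"] \<rho> by (intro w) (auto simp del: of_nat_Suc)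
      show "h * norm (L k) \<le> \<eta> / (2 * V) * V"
        using \<rho> V(3)[OF kT[of k]] k h by (intro mult_mono) auto
    qed
    also have "\<dots> = \<eta>" using V(1) by simp
    finally have "8 * C0 * (A (Suc k) - A k) \<le> 8 * C0 * \<eta>"
      using C0_nonneg by (intro mult_left_mono) auto
    then show "8 * C0 * (A (Suc k) - A k) \<le> 1" using \<eta> by simp
  qed (use \<eta> in simp)
  also have "\<dots> \<le> ((4 * C0 + 2) * \<eta>) * V * exp (8 * C0 * V)"
  proof (intro mult_mono)
    have "\<eta>\<^sup>2 \<le> \<eta>" using \<eta> by (simp add: power2_eq_square mult_left_le_one_le)
    then show "4 * C0 * \<eta>\<^sup>2 + 2 * \<eta> \<le> (4 * C0 + 2) * \<eta>"
      using mult_left_mono[of "\<eta>\<^sup>2" \<eta> "4 * C0"] C0_nonneg by (simp add: algebra_simps)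
    have "0 \<le> A i" using scheme_A_mono[of 0 i] scheme by (simp add: projection_scheme_def)
    then show AV: "A m - A i \<le> V" using V(2)[OF mT] by simp
    show "exp (8 * C0 * (A m - A i)) \<le> exp (8 * C0 * V)"
      using AV C0_nonneg by (simp add: mult_left_mono)
  qed (use V \<eta> C0_nonneg scheme_A_mono[OF im] in auto)
  finally show "(norm (L m - L i))\<^sup>2 \<le> (4 * C0 + 2) * V * exp (8 * C0 * V) * \<eta>"
    by (simp add: mult_ac)
  have "\<alpha> * (A m - A i) \<le> norm (L m - L i) * norm e"
    using scheme_push_e[OF im] norm_cauchy_schwarz[of "L m - L i" e] by linarith
  then show "A m - A i \<le> norm (L m - L i) / \<alpha>" using alpha_pos norm_e by (simp add: field_simps)
qed

end

end

section \<open>Compactness of asymptotically equicontinuous sequences\<close>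

text \<open>
  The step functions of the scheme are not continuous, but their oscillation over short times is
  small once the step is small. That suffices for the argument of Arzela and Ascoli: a diagonal
  subsequence converges at all rational times, and then uniformly on bounded intervals.
\<close>

lemma asymptotically_equicontinuous_subsequence:
  fixes F :: "nat \<Rightarrow> real \<Rightarrow> 'b::euclidean_space"
  assumes bdd: "\<And>T. T \<ge> 0 \<Longrightarrow> \<exists>M. \<forall>N. \<forall>t\<in>{0..T}. norm (F N t) \<le> M"
    and equi: "\<And>T \<epsilon>. T \<ge> 0 \<Longrightarrow> \<epsilon> > 0 \<Longrightarrow> \<exists>\<delta>>0. \<exists>N0. \<forall>N\<ge>N0. \<forall>s\<in>{0..T}. \<forall>t\<in>{0..T}.
        \<bar>s - t\<bar> < \<delta> \<longrightarrow> norm (F N s - F N t) \<le> \<epsilon>"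
  obtains k g where "strict_mono (k :: nat \<Rightarrow> nat)" "continuous_on {0..} g"
    "\<And>T. T \<ge> 0 \<Longrightarrow> uniform_limit {0..T} (\<lambda>N. F (k N)) g sequentially"
proof -
  obtain M where M: "\<And>T N t. T \<ge> 0 \<Longrightarrow> t \<in> {0..T} \<Longrightarrow> norm (F N t) \<le> M T"
    using bdd by metis
  define c where "c t = \<bar>M t\<bar> + 1" for t
  have c: "c t > 0" for t by (simp add: c_def)
  have "norm (inverse (c t) *\<^sub>R F N t) \<le> 1" if "t \<in> \<rat> \<inter> {0..}" for N t
    using M[of t t N] that c[of t] by (simp add: c_def field_simps)
  then obtain k where k: "strict_mono (k :: nat \<Rightarrow> nat)"
    and conv: "\<And>t. t \<in> \<rat> \<inter> {0..} \<Longrightarrow> \<exists>l. (\<lambda>N. inverse (c t) *\<^sub>R F (k N) t) \<longlonglongrightarrow> l"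
    using function_convergent_subsequence[of "\<rat> \<inter> {0..}" "\<lambda>N t. inverse (c t) *\<^sub>R F N t" 1]
      countable_rat by (metis countable_Int1)
  have "\<exists>l. (\<lambda>N. F (k N) t) \<longlonglongrightarrow> l" if rat: "t \<in> \<rat> \<inter> {0..}" for t
  proof -
    obtain l where "(\<lambda>N. inverse (c t) *\<^sub>R F (k N) t) \<longlonglongrightarrow> l" using conv[OF rat] by blast
    then have "(\<lambda>N. c t *\<^sub>R (inverse (c t) *\<^sub>R F (k N) t)) \<longlonglongrightarrow> c t *\<^sub>R l"
      by (intro tendsto_intros)
    then show ?thesis using c[of t] by auto
  qed
  then obtain l where l: "\<And>t. t \<in> \<rat> \<inter> {0..} \<Longrightarrow> (\<lambda>N. F (k N) t) \<longlonglongrightarrow> l t" by metis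
  define g where "g t = lim (\<lambda>N. F (k N) t)" for t
  have lim: "uniform_limit {0..T} (\<lambda>N. F (k N)) g sequentially" if T: "T \<ge> 0" for T
  proof -
    have "uniformly_Cauchy_on {0..T} (\<lambda>N. F (k N))"
    proof (rule uniformly_Cauchy_onI)
      fix \<epsilon> :: real assume eps: "\<epsilon> > 0"
      then have "\<epsilon> / 5 > 0" by simp
      from equi[OF T this] obtain \<delta> N0 where \<delta>: "\<delta> > 0" "\<And>N s t. N \<ge> N0 \<Longrightarrow> s \<in> {0..T} \<Longrightarrow> t \<in> {0..T} \<Longrightarrow>
          \<bar>s - t\<bar> < \<delta> \<Longrightarrow> norm (F N s - F N t) \<le> \<epsilon> / 5"
        by blast
      obtain m :: nat where m: "1 / \<delta> < real m" using reals_Archimedean2 by blast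
      moreover have "0 < 1 / \<delta>" using \<delta>(1) by simp
      ultimately have m0: "real m > 0" by linarith
      define q where "q i = real i / real m" for i :: nat
      have "\<forall>\<^sub>F N in sequentially. \<forall>i\<in>{..nat \<lfloor>T * m\<rfloor>}. dist (F (k N) (q i)) (l (q i)) < \<epsilon> / 5"
      proof (rule eventually_ball_finite, simp, intro ballI)
        fix i
        have "q i \<in> \<rat> \<inter> {0..}" by (auto simp: q_def)
        then show "\<forall>\<^sub>F N in sequentially. dist (F (k N) (q i)) (l (q i)) < \<epsilon> / 5"
          using l eps by (intro tendstoD) auto
      qed
      then obtain N1 where N1: "\<And>N i. N \<ge> N1 \<Longrightarrow> i \<le> nat \<lfloor>T * m\<rfloor> \<Longrightarrow>
          dist (F (k N) (q i)) (l (q i)) < \<epsilon> / 5"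
        unfolding eventually_sequentially by blast
      have near: "dist (F (k N) t) (l (q (nat \<lfloor>t * m\<rfloor>))) < 2 * \<epsilon> / 5"
        if N: "N \<ge> max N0 N1" and t: "t \<in> {0..T}" for N t
      proof -
        define i where "i = nat \<lfloor>t * m\<rfloor>"
        have i: "real i \<le> t * m" "t * m < real i + 1" using t m0 by (auto simp: i_def)
        have "k N \<ge> N0" using N seq_suble[OF k, of N] by linarith
        moreover have "q i \<le> t" using i m0 by (simp add: q_def field_simps)
        moreover have "t - q i < \<delta>"
        proof -
          have "(t - q i) * m < 1" using i m0 by (simp add: q_def left_diff_distrib)
          then have "t - q i < 1 / m" using m0 by (simp add: pos_less_divide_eq)
          also have "\<dots> < \<delta>" using m m0 \<delta>(1) by (simp add: field_simps)
          finally show ?thesis .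
        qed
        moreover have "0 \<le> q i" by (simp add: q_def)
        ultimately have "dist (F (k N) t) (F (k N) (q i)) \<le> \<epsilon> / 5"
          unfolding dist_norm using t by (intro \<delta>(2)) auto
        moreover have "dist (F (k N) (q i)) (l (q i)) < \<epsilon> / 5"
        proof (rule N1)
          have "t * m \<le> T * m" using t m0 by (intro mult_right_mono) auto
          then show "i \<le> nat \<lfloor>T * m\<rfloor>" unfolding i_def by (intro nat_mono floor_mono)
        qed (use N in simp)
        ultimately show ?thesis
          using dist_triangle[of "F (k N) t" "l (q i)" "F (k N) (q i)"] by (simp add: i_def)
      qed
      show "\<exists>M. \<forall>t\<in>{0..T}. \<forall>a\<ge>M. \<forall>b\<ge>M. dist (F (k a) t) (F (k b) t) < \<epsilon>"
      proof (intro exI[of _ "max N0 N1"] ballI allI impI)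
        fix t a b assume "t \<in> {0..T}" "a \<ge> max N0 N1" "b \<ge> max N0 N1"
        then show "dist (F (k a) t) (F (k b) t) < \<epsilon>"
          using near[of a t] near[of b t]
            dist_triangle2[of "F (k a) t" "F (k b) t" "l (q (nat \<lfloor>t * m\<rfloor>))"] eps by linarith
      qed
    qed
    then have "uniformly_convergent_on {0..T} (\<lambda>N. F (k N))" by (rule Cauchy_uniformly_convergent)
    then show ?thesis by (simp add: uniformly_convergent_uniform_limit_iff g_def[abs_def])
  qed
  have g_lim: "(\<lambda>N. F (k N) t) \<longlonglongrightarrow> g t" if "t \<ge> 0" for t
    using tendsto_uniform_limitI[OF lim[OF that], of t] that by simp
  have "continuous_on {0..} g"
    unfolding continuous_on_iff
  proof (intro ballI allI impI)
    fix t \<epsilon> :: real assume t: "t \<in> {0..}" and eps: "\<epsilon> > 0"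
    then have "\<epsilon> / 2 > 0" "t + 1 \<ge> 0" by auto
    from equi[OF this(2,1)] obtain \<delta> N0 where \<delta>: "\<delta> > 0" "\<And>N s t'. N \<ge> N0 \<Longrightarrow> s \<in> {0..t+1} \<Longrightarrow> t' \<in> {0..t+1} \<Longrightarrow>
          \<bar>s - t'\<bar> < \<delta> \<Longrightarrow> norm (F N s - F N t') \<le> \<epsilon> / 2"
      by blast
    show "\<exists>d>0. \<forall>s\<in>{0..}. dist s t < d \<longrightarrow> dist (g s) (g t) < \<epsilon>"
    proof (intro exI[of _ "min \<delta> 1"] conjI ballI impI)
      fix s assume s: "s \<in> {0..}" "dist s t < min \<delta> 1"
      have "norm (g s - g t) \<le> \<epsilon> / 2"
      proof (rule tendsto_upperbound)
        show "(\<lambda>N. norm (F (k N) s - F (k N) t)) \<longlonglongrightarrow> norm (g s - g t)"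
          using s t by (intro tendsto_intros g_lim) auto
        show "\<forall>\<^sub>F N in sequentially. norm (F (k N) s - F (k N) t) \<le> \<epsilon> / 2"
          using eventually_ge_at_top[of N0]
        proof eventually_elim
          case (elim N)
          then have "k N \<ge> N0" using seq_suble[OF k, of N] by linarith
          then show ?case using s t by (intro \<delta>(2)) (auto simp: dist_real_def)
        qed
      qed simp
      then show "dist (g s) (g t) < \<epsilon>" using eps by (simp add: dist_norm)
    qed (use \<delta> in auto)
  qed
  with k lim show thesis by (intro that)
qed

section \<open>Passage to the limit\<close>

text \<open>
  \<open>L\<close> is the derivative of \<open>J\<close> as soon as the increments of \<open>J\<close> over an interval on which \<open>L\<close> is
  nearly constant are nearly the length of the interval times that constant.
\<close>

lemma integral_eq_of_increments:
  fixes J L :: "real \<Rightarrow> 'e::euclidean_space"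
  assumes L: "continuous_on {0..} L" and J0: "J 0 = 0"
    and inc: "\<And>s t v \<epsilon>. 0 \<le> s \<Longrightarrow> s \<le> t \<Longrightarrow> 0 < \<epsilon> \<Longrightarrow> (\<And>r. s \<le> r \<Longrightarrow> r \<le> t \<Longrightarrow> norm (L r - v) \<le> \<epsilon>) \<Longrightarrow>
        norm (J t - J s - (t - s) *\<^sub>R v) \<le> \<epsilon> * (t - s)"
    and t: "0 \<le> t"
  shows "J t = integral {0..t} L"
proof -
  have "(J has_vector_derivative L r) (at r within {0..t})" if r: "r \<in> {0..t}" for r
    unfolding has_vector_derivative_def has_derivative_within_alt
  proof (intro conjI allI impI)
    show "bounded_linear (\<lambda>x. x *\<^sub>R L r)" by (rule bounded_linear_scaleR_left)
    fix \<epsilon> :: real assume eps: "\<epsilon> > 0"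
    obtain d where d: "d > 0" "\<And>q. q \<ge> 0 \<Longrightarrow> \<bar>q - r\<bar> < d \<Longrightarrow> norm (L q - L r) \<le> \<epsilon>"
      using L r eps unfolding continuous_on_iff dist_norm
      by (metis atLeastAtMost_iff atLeast_iff less_imp_le real_norm_def)
    show "\<exists>d>0. \<forall>y\<in>{0..t}. norm (y - r) < d \<longrightarrow>
        norm (J y - J r - (y - r) *\<^sub>R L r) \<le> \<epsilon> * norm (y - r)"
    proof (intro exI[of _ d] conjI ballI impI)
      fix y assume y: "y \<in> {0..t}" "norm (y - r) < d"
      show "norm (J y - J r - (y - r) *\<^sub>R L r) \<le> \<epsilon> * norm (y - r)"
      proof (cases "r \<le> y")
        case True
        then show ?thesis using inc[of r y \<epsilon> "L r"] d y r eps by auto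
      next
        case False
        have "norm (J r - J y - (r - y) *\<^sub>R L r) \<le> \<epsilon> * (r - y)"
          using False d y r eps by (intro inc) auto
        moreover have "J y - J r - (y - r) *\<^sub>R L r = - (J r - J y - (r - y) *\<^sub>R L r)"
          by (simp add: algebra_simps)
        ultimately show ?thesis using False by (simp only: norm_minus_cancel) auto
      qed
    qed (rule d)
  qed
  then have "(L has_integral J t - J 0) {0..t}" by (rule fundamental_theorem_of_calculus[OF t])
  then show ?thesis using J0 by (simp add: integral_unique)
qed

context reflecting_domain
begin

text \<open>
  Uniformly close paths visit the boundary close to where \<open>x\<close> runs; the boundary points with
  normals far from \<open>v\<close> form a closed set, which keeps a positive distance from the compact path of
  \<open>x\<close>.
\<close>

lemma normal_near_of_close_path:
  fixes s t :: real
  assumes x: "continuous_on {s..t} x" and \<eta>: "\<eta> > 0"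
    and near: "\<And>r. r \<in> {s..t} \<Longrightarrow> x r \<in> frontier D \<Longrightarrow> norm (n (x r) - v) \<le> \<epsilon>"
  obtains d where "d > 0" "\<And>r p. r \<in> {s..t} \<Longrightarrow> p \<in> frontier D \<Longrightarrow> dist p (x r) < d \<Longrightarrow>
      norm (n p - v) \<le> \<epsilon> + \<eta>"
proof -
  let ?C = "frontier D \<inter> (\<lambda>p. norm (n p - v)) -` {\<epsilon> + \<eta>..}"
  have "closed ?C"
    by (intro continuous_closed_preimage continuous_intros continuous_normal) auto
  moreover have "compact (x ` {s..t})" by (rule compact_continuous_image[OF x compact_Icc])
  moreover have "x ` {s..t} \<inter> ?C = {}" using near \<eta> by fastforce
  ultimately obtain d where "d > 0" and sep: "\<And>q p. q \<in> x ` {s..t} \<Longrightarrow> p \<in> ?C \<Longrightarrow> d \<le> dist q p"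
    using separate_compact_closed by metis
  then show thesis
  proof (intro that[of d])
    fix r p assume r: "r \<in> {s..t}" and p: "p \<in> frontier D" "dist p (x r) < d"
    then have "p \<notin> ?C" using sep[of "x r" p] by (auto simp: dist_commute)
    with p(1) show "norm (n p - v) \<le> \<epsilon> + \<eta>" by auto
  qed
qed

lemma pushed_along_limit:
  assumes x: "continuous_on {0..} x"
    and limx: "\<And>T. T \<ge> 0 \<Longrightarrow> uniform_limit {0..T} X x sequentially"
    and limL: "\<And>t. t \<ge> 0 \<Longrightarrow> (\<lambda>N. Ls N t) \<longlonglongrightarrow> L t"
    and limA: "\<And>t. t \<ge> 0 \<Longrightarrow> (\<lambda>N. As N t) \<longlonglongrightarrow> A t"
    and push: "\<And>N :: nat. pushed_along (frontier D) n (X N) (Ls N) (As N)"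
  shows "pushed_along (frontier D) n x L A"
  unfolding pushed_along_def
proof (intro allI impI)
  fix s t :: real and v \<epsilon>
  assume st: "0 \<le> s" "s \<le> t" and eps: "0 \<le> \<epsilon>"
    and near: "\<forall>r\<in>{s..t}. x r \<in> frontier D \<longrightarrow> norm (n (x r) - v) \<le> \<epsilon>"
  have le: "norm (L t - L s - (A t - A s) *\<^sub>R v) \<le> (\<epsilon> + \<eta>) * (A t - A s)" if \<eta>: "\<eta> > 0" for \<eta>
  proof -
    have "continuous_on {s..t} x" by (rule continuous_on_subset[OF x]) (use st in auto)
    then obtain d where d: "d > 0" "\<And>r p. r \<in> {s..t} \<Longrightarrow> p \<in> frontier D \<Longrightarrow> dist p (x r) < d \<Longrightarrow>
      norm (n p - v) \<le> \<epsilon> + \<eta>"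
      by (rule normal_near_of_close_path[OF _ \<eta>]) (use near in auto)
    have "\<forall>\<^sub>F N in sequentially. \<forall>r\<in>{0..t}. dist (X N r) (x r) < d"
      using limx[of t] st d(1) unfolding uniform_limit_iff by simp
    then have "\<forall>\<^sub>F N in sequentially. norm (Ls N t - Ls N s - (As N t - As N s) *\<^sub>R v) \<le>
        (\<epsilon> + \<eta>) * (As N t - As N s)"
    proof eventually_elim
      case (elim N)
      show ?case
      proof (rule pushed_alongD[OF push st])
        fix r assume r: "s \<le> r" "r \<le> t" "X N r \<in> frontier D"
        show "norm (n (X N r) - v) \<le> \<epsilon> + \<eta>" using d(2)[of r "X N r"] elim r st by auto
      qed (use eps \<eta> in simp)
    qed
    moreover have "(\<lambda>N. norm (Ls N t - Ls N s - (As N t - As N s) *\<^sub>R v)) \<longlonglongrightarrow>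
        norm (L t - L s - (A t - A s) *\<^sub>R v)"
      using st by (intro tendsto_intros limL limA) auto
    moreover have "(\<lambda>N. (\<epsilon> + \<eta>) * (As N t - As N s)) \<longlonglongrightarrow> (\<epsilon> + \<eta>) * (A t - A s)"
      using st by (intro tendsto_intros limA) auto
    ultimately show ?thesis by (intro tendsto_le[OF trivial_limit_sequentially])
  qed
  show "norm (L t - L s - (A t - A s) *\<^sub>R v) \<le> \<epsilon> * (A t - A s)"
  proof (rule tendsto_lowerbound[where F = "at_right 0"])
    show "((\<lambda>\<eta>. (\<epsilon> + \<eta>) * (A t - A s)) \<longlongrightarrow> \<epsilon> * (A t - A s)) (at_right 0)"
      by (auto intro!: tendsto_eq_intros)
    show "\<forall>\<^sub>F \<eta> in at_right 0. norm (L t - L s - (A t - A s) *\<^sub>R v) \<le> (\<epsilon> + \<eta>) * (A t - A s)"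
      using eventually_at_right_less[of 0] by eventually_elim (rule le)
  qed simp
qed

end

section \<open>Existence\<close>

definition grid_index :: "nat \<Rightarrow> real \<Rightarrow> nat" where
  "grid_index N t = nat \<lfloor>t * real (Suc N)\<rfloor>"

definition mesh :: "nat \<Rightarrow> real" where
  "mesh N = 1 / real (Suc N)"

lemma mesh_pos: "mesh N > 0"
  by (simp add: mesh_def)

lemma mesh_tendsto_0: "mesh \<longlonglongrightarrow> 0"
  unfolding mesh_def[abs_def] by (rule LIMSEQ_Suc) (rule lim_1_over_n)

lemma grid_index_bounds:
  assumes "t \<ge> 0"
  shows "real (grid_index N t) * mesh N \<le> t" "t < real (grid_index N t) * mesh N + mesh N"
proof -
  have "real (grid_index N t) \<le> t * real (Suc N)" "t * real (Suc N) < real (grid_index N t) + 1"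
    using assms by (auto simp: grid_index_def)
  then show "real (grid_index N t) * mesh N \<le> t" "t < real (grid_index N t) * mesh N + mesh N"
    by (simp_all add: mesh_def field_simps)
qed

lemma grid_index_mono: "s \<le> t \<Longrightarrow> grid_index N s \<le> grid_index N t"
  unfolding grid_index_def by (intro nat_mono floor_mono mult_right_mono) auto

lemma grid_index_grid: "grid_index N (real k * mesh N) = k"
  by (simp add: grid_index_def mesh_def)

lemma grid_point_mem:
  assumes "0 \<le> s" "grid_index N s < k" "k \<le> grid_index N t" "0 \<le> t"
  shows "s \<le> real k * mesh N" "real k * mesh N \<le> t"
proof -
  have "real (grid_index N s) + 1 \<le> real k" using assms(2) by linarith
  then have "(real (grid_index N s) + 1) * mesh N \<le> real k * mesh N"
    using mesh_pos[of N] by (intro mult_right_mono) auto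
  then show "s \<le> real k * mesh N"
    using grid_index_bounds(2)[OF assms(1), of N] by (simp add: algebra_simps)
  have "real k * mesh N \<le> real (grid_index N t) * mesh N"
    using assms(3) mesh_pos[of N] by (intro mult_right_mono) auto
  then show "real k * mesh N \<le> t" using grid_index_bounds(1)[OF assms(4), of N] by linarith
qed

lemma grid_time_tendsto:
  assumes "t \<ge> 0" "strict_mono k"
  shows "(\<lambda>N. real (grid_index (k N) t) * mesh (k N)) \<longlonglongrightarrow> t"
proof (rule tendsto_sandwich)
  have "(\<lambda>N. mesh (k N)) \<longlonglongrightarrow> 0"
    using LIMSEQ_subseq_LIMSEQ[OF mesh_tendsto_0 assms(2)] by (simp add: o_def)
  then show "(\<lambda>N. t - mesh (k N)) \<longlonglongrightarrow> t" by (auto intro!: tendsto_eq_intros)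
  show "\<forall>\<^sub>F N in sequentially. t - mesh (k N) \<le> real (grid_index (k N) t) * mesh (k N)"
    using grid_index_bounds(2)[OF assms(1)] by (intro always_eventually allI) (smt (verit))
qed (use grid_index_bounds(1)[OF assms(1)] in auto)

lemma uniform_limit_grid:
  fixes w :: "real \<Rightarrow> 'e::metric_space"
  assumes w: "continuous_on {0..} w" and k: "strict_mono k"
  shows "uniform_limit {0..T} (\<lambda>N t. w (real (grid_index (k N) t) * mesh (k N))) w sequentially"
proof (rule uniform_limitI)
  fix \<epsilon> :: real assume "\<epsilon> > 0"
  have "uniformly_continuous_on {0..T} w"
    by (intro compact_uniformly_continuous continuous_on_subset[OF w]) auto
  then obtain \<delta> where \<delta>: "\<delta> > 0" "\<And>r t. r \<in> {0..T} \<Longrightarrow> t \<in> {0..T} \<Longrightarrow> dist r t < \<delta> \<Longrightarrow> dist (w r) (w t) < \<epsilon>"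
    using \<open>\<epsilon> > 0\<close> unfolding uniformly_continuous_on_def by metis
  have "(\<lambda>N. mesh (k N)) \<longlonglongrightarrow> 0"
    using LIMSEQ_subseq_LIMSEQ[OF mesh_tendsto_0 k] by (simp add: o_def)
  then have "\<forall>\<^sub>F N in sequentially. mesh (k N) < \<delta>" using \<delta>(1) by (rule order_tendstoD)
  then show "\<forall>\<^sub>F N in sequentially. \<forall>t\<in>{0..T}. dist (w (real (grid_index (k N) t) * mesh (k N))) (w t) < \<epsilon>"
  proof eventually_elim
    case (elim N)
    show ?case
    proof
      fix t assume t: "t \<in> {0..T}"
      let ?r = "real (grid_index (k N) t) * mesh (k N)"
      have "0 \<le> ?r" using mesh_pos[of "k N"] by simp
      moreover have "?r \<le> t" "t < ?r + mesh (k N)" using grid_index_bounds[of t] t by auto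
      ultimately show "dist (w ?r) (w t) < \<epsilon>"
        using t elim by (intro \<delta>(2)) (auto simp: dist_real_def)
    qed
  qed
qed

context reflecting_domain
begin

lemma scheme_steps_pushed:
  assumes "projection_scheme w (mesh N) J L A"
  shows "pushed_along (frontier D) n
      (\<lambda>t. w (real (grid_index N t) * mesh N) + J (grid_index N t) + L (grid_index N t))
      (\<lambda>t. L (grid_index N t)) (\<lambda>t. A (grid_index N t))"
  unfolding pushed_along_def
proof (intro allI impI)
  fix s t :: real and v \<epsilon>
  assume st: "0 \<le> s" "s \<le> t" and eps: "0 \<le> \<epsilon>"
    and near: "\<forall>r\<in>{s..t}. w (real (grid_index N r) * mesh N) + J (grid_index N r) + L (grid_index N r) \<in> frontier D \<longrightarrow>
      norm (n (w (real (grid_index N r) * mesh N) + J (grid_index N r) + L (grid_index N r)) - v) \<le> \<epsilon>"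
  show "norm (L (grid_index N t) - L (grid_index N s) - (A (grid_index N t) - A (grid_index N s)) *\<^sub>R v)
      \<le> \<epsilon> * (A (grid_index N t) - A (grid_index N s))"
  proof (rule scheme_push_increment[OF assms mesh_pos grid_index_mono[OF st(2)] eps])
    fix k assume k: "grid_index N s < k" "k \<le> grid_index N t"
      and fr: "w (real k * mesh N) + J k + L k \<in> frontier D"
    have "real k * mesh N \<in> {s..t}" using grid_point_mem[OF st(1) k] st by auto
    from near[rule_format, OF this] show "norm (n (w (real k * mesh N) + J k + L k) - v) \<le> \<epsilon>"
      using fr by (simp add: grid_index_grid)
  qed
qed

lemma scheme_steps_drift:
  assumes "projection_scheme w (mesh N) J L A" and st: "0 \<le> s" "s \<le> t"
    and near: "\<And>r. s \<le> r \<Longrightarrow> r \<le> t \<Longrightarrow> norm (L (grid_index N r) - v) \<le> \<epsilon>"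
  defines "\<theta> \<equiv> real (grid_index N t) * mesh N - real (grid_index N s) * mesh N"
  shows "norm (J (grid_index N t) - J (grid_index N s) - \<theta> *\<^sub>R v) \<le> \<epsilon> * \<theta>"
proof -
  have im: "grid_index N s \<le> grid_index N t" by (rule grid_index_mono[OF st(2)])
  then have \<theta>: "\<theta> = real (grid_index N t - grid_index N s) * mesh N"
    by (simp add: \<theta>_def of_nat_diff left_diff_distrib)
  show ?thesis
    unfolding \<theta>
  proof (rule scheme_drift_increment[OF assms(1) mesh_pos im])
    fix k assume k: "grid_index N s \<le> k" "k < grid_index N t"
    show "norm (L k - v) \<le> \<epsilon>"
    proof (cases "k = grid_index N s")
      case True
      then show ?thesis using near[of s] st by simp
    next
      case False
      then have "s \<le> real k * mesh N" "real k * mesh N \<le> t"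
        using grid_point_mem[OF st(1), of N k t] k st by auto
      from near[OF this] show ?thesis by (simp add: grid_index_grid)
    qed
  qed
qed

text \<open>
  Here the constants come together: \<open>\<eta>\<close> bounds the oscillation of the input, and the push inherits
  the modulus \<open>sqrt (K \<eta>)\<close>.
\<close>

lemma scheme_steps_equicontinuous:
  assumes scheme: "\<And>N. projection_scheme w (mesh N) (J N) (L N) (A N)"
    and w: "continuous_on {0..} w" and T: "T \<ge> 0" and eps: "\<epsilon> > 0"
  obtains \<delta> :: real and N0 where "\<delta> > 0" "\<And>N s t. N \<ge> N0 \<Longrightarrow> 0 \<le> s \<Longrightarrow> s \<le> t \<Longrightarrow> t \<le> T \<Longrightarrow> t - s < \<delta> \<Longrightarrow>
      norm (J N (grid_index N t) - J N (grid_index N s)) \<le> \<epsilon> \<and>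
      norm (L N (grid_index N t) - L N (grid_index N s)) \<le> \<epsilon> \<and>
      A N (grid_index N t) - A N (grid_index N s) \<le> \<epsilon> / \<alpha>"
proof -
  have contT: "continuous_on {0..T} w" by (rule continuous_on_subset[OF w]) auto
  have "bounded (w ` {0..T})"
    by (intro compact_imp_bounded compact_continuous_image contT compact_Icc)
  then obtain W where "\<forall>x\<in>w ` {0..T}. norm x \<le> W" unfolding bounded_iff by blast
  then have W: "\<And>t. 0 \<le> t \<Longrightarrow> t \<le> T \<Longrightarrow> norm (w t) \<le> W" by auto
  define V where "V = max 0 (R + W) / \<alpha> + 1"
  have V: "V > 0" using alpha_pos by (simp add: V_def add_nonneg_pos)
  have AL: "A N k \<le> V" "norm (L N k) \<le> V" if "real k * mesh N \<le> T" for N k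
    using scheme_bound[OF scheme mesh_pos W that refl] by (auto simp: V_def)
  define K where "K = (4 * C0 + 2) * V * exp (8 * C0 * V)"
  have K: "K > 0" using C0_nonneg V by (simp add: K_def)
  define \<eta> where "\<eta> = min (min 1 (1 / (8 * C0 + 1))) (min \<epsilon> (\<epsilon>\<^sup>2 / K))"
  have \<eta>: "0 < \<eta>" "\<eta> \<le> 1" "\<eta> \<le> 1 / (8 * C0 + 1)" "\<eta> \<le> \<epsilon>" "\<eta> \<le> \<epsilon>\<^sup>2 / K"
  proof -
    show "0 < \<eta>" using eps K C0_nonneg by (auto simp: \<eta>_def)
    show "\<eta> \<le> 1" "\<eta> \<le> 1 / (8 * C0 + 1)" "\<eta> \<le> \<epsilon>" "\<eta> \<le> \<epsilon>\<^sup>2 / K"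
      unfolding \<eta>_def by linarith+
  qed
  have \<eta>8: "8 * C0 * \<eta> \<le> 1"
    using \<eta>(1,3) C0_nonneg by (simp add: field_simps)
  have "uniformly_continuous_on {0..T} w"
    by (intro compact_uniformly_continuous contT compact_Icc)
  then obtain \<rho>' where \<rho>': "\<rho>' > 0" "\<And>r r'. r \<in> {0..T} \<Longrightarrow> r' \<in> {0..T} \<Longrightarrow> dist r r' < \<rho>' \<Longrightarrow>
      dist (w r) (w r') < \<eta> / 2"
    using \<eta>(1) half_gt_zero unfolding uniformly_continuous_on_def by metis
  define \<rho> where "\<rho> = min \<rho>' (\<eta> / (2 * V))"
  have \<rho>: "\<rho> > 0" "\<rho> \<le> \<eta> / (2 * V)" using \<rho>' \<eta> V by (auto simp: \<rho>_def)
  have osc: "norm (w r - w r') \<le> \<eta> / 2"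
    if "0 \<le> r" "r \<le> T" "0 \<le> r'" "r' \<le> T" "\<bar>r - r'\<bar> < \<rho>" for r r'
    using \<rho>'(2)[of r r'] that by (simp add: \<rho>_def dist_norm)
  have "\<forall>\<^sub>F N in sequentially. mesh N < \<rho> / 2"
    using \<rho>(1) by (intro order_tendstoD(2)[OF mesh_tendsto_0]) simp
  then obtain N0 where N0: "\<And>N. N \<ge> N0 \<Longrightarrow> mesh N < \<rho> / 2"
    unfolding eventually_sequentially by blast
  show thesis
  proof (rule that[of "\<rho> / 2" N0])
    fix N s t assume N: "N \<ge> N0" and st: "0 \<le> s" "s \<le> t" "t \<le> T" "t - s < \<rho> / 2"
    let ?i = "grid_index N s" and ?m = "grid_index N t"
    have im: "?i \<le> ?m" by (rule grid_index_mono[OF st(2)])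
    have mT: "real ?m * mesh N \<le> T" using grid_index_bounds(1)[of t N] st by simp
    have gap: "real (?m - ?i) * mesh N < \<rho>"
      using grid_index_bounds[of t N] grid_index_bounds[of s N] st im N0[OF N]
      by (simp add: of_nat_diff left_diff_distrib)
    have h: "mesh N < \<rho>" using N0[OF N] \<rho>(1) by simp
    note mod = scheme_modulus[OF scheme mesh_pos im mT V AL \<eta>(1,2) \<eta>8 \<rho>(2) h gap osc]
    have "(norm (L N ?m - L N ?i))\<^sup>2 \<le> K * \<eta>" using mod(2) by (simp add: K_def)
    also have "\<dots> \<le> K * (\<epsilon>\<^sup>2 / K)" using \<eta>(5) K by (intro mult_left_mono) auto
    finally have "(norm (L N ?m - L N ?i))\<^sup>2 \<le> \<epsilon>\<^sup>2" using K by simp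
    then have L: "norm (L N ?m - L N ?i) \<le> \<epsilon>" by (rule power2_le_imp_le) (use eps in simp)
    then have "norm (L N ?m - L N ?i) / \<alpha> \<le> \<epsilon> / \<alpha>" using alpha_pos by (simp add: divide_right_mono)
    then show "norm (J N ?m - J N ?i) \<le> \<epsilon> \<and> norm (L N ?m - L N ?i) \<le> \<epsilon> \<and> A N ?m - A N ?i \<le> \<epsilon> / \<alpha>"
      using mod(1,3) L \<eta>(4) by linarith
  qed (use \<rho> in simp)
qed

text \<open>
  All three components are bounded and asymptotically equicontinuous, and every property of the
  scheme passes to the limit.
\<close>

theorem push_solution_exists:
  assumes w: "continuous_on {0..} w" and w0: "w 0 \<in> closure D"
  obtains x L A where "push_solution w D n x L A"
proof -
  have "\<exists>J L A. projection_scheme w (mesh N) J L A" for N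
    using projection_scheme_exists[where w = w and h = "mesh N", OF w0] by metis
  then obtain J L A where scheme: "\<And>N. projection_scheme w (mesh N) (J N) (L N) (A N)" by metis
  define Js where "Js N t = J N (grid_index N t)" for N t
  define Ls where "Ls N t = L N (grid_index N t)" for N t
  define As where "As N t = A N (grid_index N t)" for N t
  define F where "F N t = (Js N t, Ls N t, As N t)" for N t
  have normF: "norm (a, b, c) \<le> norm a + norm b + \<bar>c\<bar>" for a b :: 'e and c :: real
    using norm_Pair_le[of a "(b, c)"] norm_Pair_le[of b c] by simp
  have A0: "A N 0 = 0" and J0: "J N 0 = 0" and L0: "L N 0 = 0" for N
    using scheme[of N] by (auto simp: projection_scheme_def)
  have bdd: "\<exists>M. \<forall>N. \<forall>t\<in>{0..T}. norm (F N t) \<le> M" if T: "T \<ge> 0" for T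
  proof -
    have "bounded (w ` {0..T})"
      by (intro compact_imp_bounded compact_continuous_image continuous_on_subset[OF w] compact_Icc) auto
    then obtain W where "\<forall>x\<in>w ` {0..T}. norm x \<le> W" unfolding bounded_iff by blast
    then have W: "\<And>t. 0 \<le> t \<Longrightarrow> t \<le> T \<Longrightarrow> norm (w t) \<le> W" by auto
    define V where "V = max 0 (R + W) / \<alpha>"
    have V0: "V \<ge> 0" using alpha_pos by (simp add: V_def)
    have AL: "A N k \<le> V" "norm (L N k) \<le> V" if "real k * mesh N \<le> T" for N k
      using scheme_bound[OF scheme mesh_pos W that V_def] by auto
    have "norm (F N t) \<le> V * T + V + V" if t: "t \<in> {0..T}" for N t
    proof -
      have gT: "real (grid_index N t) * mesh N \<le> T" using grid_index_bounds(1)[of t N] t by simp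
      have "norm (J N (grid_index N t) - J N 0 - (real (grid_index N t - 0) * mesh N) *\<^sub>R 0)
          \<le> V * (real (grid_index N t - 0) * mesh N)"
      proof (rule scheme_drift_increment[OF scheme mesh_pos])
        fix k assume "k < grid_index N t"
        then have "real k * mesh N \<le> real (grid_index N t) * mesh N"
          using mesh_pos[of N] by (intro mult_right_mono) auto
        then show "norm (L N k - 0) \<le> V" using AL(2)[of k N] gT by simp
      qed simp
      also have "\<dots> \<le> V * T" using gT V0 by (intro mult_left_mono) auto
      finally have "norm (Js N t) \<le> V * T" by (simp add: Js_def J0)
      moreover have "norm (Ls N t) \<le> V" "As N t \<le> V"
        using AL[OF gT] by (auto simp: Ls_def As_def)
      moreover have "0 \<le> As N t"
        using scheme_A_mono[OF scheme mesh_pos, of 0 "grid_index N t" N] by (simp add: As_def A0)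
      ultimately show ?thesis using normF[of "Js N t" "Ls N t" "As N t"] by (simp add: F_def)
    qed
    then show ?thesis by blast
  qed
  have equi: "\<exists>\<delta>>0. \<exists>N0. \<forall>N\<ge>N0. \<forall>s\<in>{0..T}. \<forall>t\<in>{0..T}. \<bar>s - t\<bar> < \<delta> \<longrightarrow> norm (F N s - F N t) \<le> \<epsilon>"
    if T: "T \<ge> 0" and eps: "\<epsilon> > 0" for T \<epsilon>
  proof -
    define \<epsilon>' where "\<epsilon>' = \<epsilon> / (2 + 1 / \<alpha>)"
    have a: "2 + 1 / \<alpha> > 0" using alpha_pos by (simp add: add_pos_pos)
    have eps': "\<epsilon>' > 0" using eps a by (simp add: \<epsilon>'_def)
    have "\<epsilon>' * (2 + 1 / \<alpha>) = \<epsilon>" using a by (simp add: \<epsilon>'_def)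
    then have sum: "\<epsilon>' + \<epsilon>' + \<epsilon>' / \<alpha> = \<epsilon>" by (simp add: algebra_simps)
    obtain \<delta> N0 where \<delta>: "\<delta> > 0" "\<And>N s t. N \<ge> N0 \<Longrightarrow> 0 \<le> s \<Longrightarrow> s \<le> t \<Longrightarrow> t \<le> T \<Longrightarrow> t - s < \<delta> \<Longrightarrow>
      norm (J N (grid_index N t) - J N (grid_index N s)) \<le> \<epsilon>' \<and>
      norm (L N (grid_index N t) - L N (grid_index N s)) \<le> \<epsilon>' \<and>
      A N (grid_index N t) - A N (grid_index N s) \<le> \<epsilon>' / \<alpha>"
      using scheme_steps_equicontinuous[OF scheme w T eps'] by metis
    have one: "norm (F N t - F N s) \<le> \<epsilon>"
      if "N \<ge> N0" "0 \<le> s" "s \<le> t" "t \<le> T" "t - s < \<delta>" for N s t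
      using \<delta>(2)[OF that] sum scheme_A_mono[OF scheme mesh_pos grid_index_mono[OF that(3)], of N N]
        normF[of "Js N t - Js N s" "Ls N t - Ls N s" "As N t - As N s"]
      by (simp add: F_def Js_def Ls_def As_def)
    show ?thesis
    proof (intro exI[of _ \<delta>] exI[of _ N0] conjI allI impI ballI)
      fix N s t assume "N \<ge> N0" "s \<in> {0..T}" "t \<in> {0..T}" "\<bar>s - t\<bar> < \<delta>"
      then show "norm (F N s - F N t) \<le> \<epsilon>"
        using one[of N s t] one[of N t s] by (cases "s \<le> t") (auto simp: norm_minus_commute)
    qed (rule \<delta>(1))
  qed
  obtain k g where k: "strict_mono (k :: nat \<Rightarrow> nat)" and g: "continuous_on {0..} g"
    and lim: "\<And>T. T \<ge> 0 \<Longrightarrow> uniform_limit {0..T} (\<lambda>N. F (k N)) g sequentially"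
    using bdd equi that by (rule asymptotically_equicontinuous_subsequence[of F])
  define Jl where "Jl t = fst (g t)" for t
  define Ll where "Ll t = fst (snd (g t))" for t
  define Al where "Al t = snd (snd (g t))" for t
  define x where "x t = w t + Jl t + Ll t" for t
  define X where "X N t = w (real (grid_index (k N) t) * mesh (k N)) + Js (k N) t + Ls (k N) t" for N t
  have contl: "continuous_on {0..} Jl" "continuous_on {0..} Ll"
    unfolding Jl_def Ll_def by (intro continuous_intros g)+
  have x_cont: "continuous_on {0..} x" unfolding x_def by (intro continuous_intros w contl)
  have limJ: "uniform_limit {0..T} (\<lambda>N. Js (k N)) Jl sequentially"
    and limL: "uniform_limit {0..T} (\<lambda>N. Ls (k N)) Ll sequentially"
    and limA: "uniform_limit {0..T} (\<lambda>N. As (k N)) Al sequentially" if "T \<ge> 0" for T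
    using bounded_linear.uniform_limit[OF bounded_linear_fst lim[OF that]]
      bounded_linear.uniform_limit[OF bounded_linear_fst
        bounded_linear.uniform_limit[OF bounded_linear_snd lim[OF that]]]
      bounded_linear.uniform_limit[OF bounded_linear_snd
        bounded_linear.uniform_limit[OF bounded_linear_snd lim[OF that]]]
    by (simp_all add: F_def Jl_def[abs_def] Ll_def[abs_def] Al_def[abs_def])
  have pJ: "(\<lambda>N. Js (k N) t) \<longlonglongrightarrow> Jl t" and pL: "(\<lambda>N. Ls (k N) t) \<longlonglongrightarrow> Ll t"
    and pA: "(\<lambda>N. As (k N) t) \<longlonglongrightarrow> Al t" if "t \<ge> 0" for t
    using tendsto_uniform_limitI[OF limJ[OF that], of t] tendsto_uniform_limitI[OF limL[OF that], of t]
      tendsto_uniform_limitI[OF limA[OF that], of t] that by auto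
  have limX: "uniform_limit {0..T} X x sequentially" if "T \<ge> 0" for T
    unfolding X_def[abs_def] x_def[abs_def]
    by (intro uniform_limit_add uniform_limit_grid[OF w k] limJ[OF that] limL[OF that])
  have init: "Jl 0 = 0" "Ll 0 = 0" "Al 0 = 0"
    using LIMSEQ_unique[OF pJ[of 0]] LIMSEQ_unique[OF pL[of 0]] LIMSEQ_unique[OF pA[of 0]]
    by (auto simp: Js_def Ls_def As_def J0 L0 A0 grid_index_def)
  have xD: "x t \<in> closure D" if t: "t \<ge> 0" for t
  proof (rule closed_sequentially[OF closed_closure])
    show "X N t \<in> closure D" for N
      using scheme[of "k N"] by (simp add: X_def Js_def Ls_def projection_scheme_def)
    show "(\<lambda>N. X N t) \<longlonglongrightarrow> x t" using tendsto_uniform_limitI[OF limX[OF t], of t] t by simp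
  qed
  have push: "pushed_along (frontier D) n x Ll Al"
  proof (rule pushed_along_limit[OF x_cont limX pL pA])
    show "pushed_along (frontier D) n (X N) (Ls (k N)) (As (k N))" for N
      using scheme_steps_pushed[OF scheme[of "k N"]]
      by (simp add: X_def[abs_def] Js_def[abs_def] Ls_def[abs_def] As_def[abs_def])
  qed
  have drift: "Jl t = integral {0..t} Ll" if t: "t \<ge> 0" for t
  proof (rule integral_eq_of_increments[where J = Jl, OF contl(2) init(1) _ t])
    fix s t \<epsilon> :: real and v
    assume st: "0 \<le> s" "s \<le> t" and eps: "0 < \<epsilon>"
      and near: "\<And>r. s \<le> r \<Longrightarrow> r \<le> t \<Longrightarrow> norm (Ll r - v) \<le> \<epsilon>"
    define \<theta> where "\<theta> N = real (grid_index (k N) t) * mesh (k N) - real (grid_index (k N) s) * mesh (k N)" for N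
    have \<theta>: "\<theta> \<longlonglongrightarrow> t - s"
      unfolding \<theta>_def[abs_def] using st by (intro tendsto_diff grid_time_tendsto k) auto
    have le: "norm (Jl t - Jl s - (t - s) *\<^sub>R v) \<le> (\<epsilon> + \<eta>) * (t - s)" if \<eta>: "\<eta> > 0" for \<eta>
    proof -
      have "\<forall>\<^sub>F N in sequentially. \<forall>r\<in>{0..t}. dist (Ls (k N) r) (Ll r) < \<eta>"
        using limL[of t] st \<eta> unfolding uniform_limit_iff by simp
      then have "\<forall>\<^sub>F N in sequentially. norm (Js (k N) t - Js (k N) s - \<theta> N *\<^sub>R v) \<le> (\<epsilon> + \<eta>) * \<theta> N"
      proof eventually_elim
        case (elim N)
        show ?case
          unfolding Js_def \<theta>_def
        proof (rule scheme_steps_drift[OF scheme st])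
          fix r assume r: "s \<le> r" "r \<le> t"
          have "norm (Ls (k N) r - v) \<le> norm (Ls (k N) r - Ll r) + norm (Ll r - v)"
            using norm_triangle_ineq[of "Ls (k N) r - Ll r" "Ll r - v"] by simp
          also have "\<dots> \<le> \<eta> + \<epsilon>"
            using elim[rule_format, of r] near[OF r] r st by (auto simp: dist_norm)
          finally show "norm (L (k N) (grid_index (k N) r) - v) \<le> \<epsilon> + \<eta>" by (simp add: Ls_def)
        qed
      qed
      moreover have "(\<lambda>N. norm (Js (k N) t - Js (k N) s - \<theta> N *\<^sub>R v)) \<longlonglongrightarrow>
          norm (Jl t - Jl s - (t - s) *\<^sub>R v)"
        using st by (intro tendsto_intros pJ \<theta>) auto
      moreover have "(\<lambda>N. (\<epsilon> + \<eta>) * \<theta> N) \<longlonglongrightarrow> (\<epsilon> + \<eta>) * (t - s)" by (intro tendsto_intros \<theta>)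
      ultimately show ?thesis by (intro tendsto_le[OF trivial_limit_sequentially])
    qed
    show "norm (Jl t - Jl s - (t - s) *\<^sub>R v) \<le> \<epsilon> * (t - s)"
    proof (rule tendsto_lowerbound[where F = "at_right 0"])
      show "((\<lambda>\<eta>. (\<epsilon> + \<eta>) * (t - s)) \<longlongrightarrow> \<epsilon> * (t - s)) (at_right 0)"
        by (auto intro!: tendsto_eq_intros)
      show "\<forall>\<^sub>F \<eta> in at_right 0. norm (Jl t - Jl s - (t - s) *\<^sub>R v) \<le> (\<epsilon> + \<eta>) * (t - s)"
        using eventually_at_right_less[of 0] by eventually_elim (rule le)
    qed simp
  qed
  have "push_solution w D n x Ll Al"
    unfolding push_solution_def using x_cont xD contl(2) init push drift by (simp add: x_def)
  then show thesis by (rule that)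
qed

end

section \<open>Total variation\<close>

lemma variation_sums_le:
  fixes L :: "real \<Rightarrow> 'e::real_normed_vector" and A :: "real \<Rightarrow> real"
  assumes t: "a \<le> t" and dom: "\<And>r s. a \<le> r \<Longrightarrow> r \<le> s \<Longrightarrow> s \<le> t \<Longrightarrow> norm (L s - L r) \<le> A s - A r"
    and v: "v \<in> variation_sums {a..t} L"
  shows "v \<le> A t - A a"
proof -
  obtain ps where ps: "sorted ps" "set ps \<subseteq> {a..t}"
    and v: "v = (\<Sum>i<length ps - 1. norm (L (ps ! Suc i) - L (ps ! i)))"
    using v by (auto simp: variation_sums_def)
  have mono: "A r \<le> A s" if "a \<le> r" "r \<le> s" "s \<le> t" for r s
    using dom[OF that] norm_ge_zero[of "L s - L r"] by linarith
  have mem: "ps ! i \<in> {a..t}" if "i < length ps" for i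
    using ps(2) that nth_mem by blast
  show ?thesis
  proof (cases "ps = []")
    case False
    have "v \<le> (\<Sum>i<length ps - 1. A (ps ! Suc i) - A (ps ! i))"
      unfolding v
    proof (rule sum_mono)
      fix i assume "i \<in> {..<length ps - 1}"
      then have i: "Suc i < length ps" by auto
      show "norm (L (ps ! Suc i) - L (ps ! i)) \<le> A (ps ! Suc i) - A (ps ! i)"
        using mem[of i] mem[of "Suc i"] i sorted_nth_mono[OF ps(1), of i "Suc i"] by (intro dom) auto
    qed
    also have "\<dots> = A (ps ! (length ps - 1)) - A (ps ! 0)"
      by (rule sum_lessThan_telescope)
    also have "\<dots> \<le> A t - A a"
      using mem[of 0] mem[of "length ps - 1"] False mono[of "ps ! (length ps - 1)" t] mono[of a "ps ! 0"]
      by auto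
    finally show ?thesis .
  qed (use v mono[of a t] t in simp)
qed

lemma variation_sums_nonempty: "variation_sums S L \<noteq> {}"
  by (auto simp: variation_sums_def intro!: exI[of _ "[]"])

lemma variation_sums_mono: "S \<subseteq> T \<Longrightarrow> variation_sums S L \<subseteq> variation_sums T L"
  by (auto simp: variation_sums_def)

text \<open>
  Minimality of the total variation among the functions whose increments dominate those of \<open>L\<close>. It
  gives both the right continuity and, below, the identification with the clock.
\<close>

lemma total_variation_le:
  assumes "0 \<le> t" "\<And>r s. 0 \<le> r \<Longrightarrow> r \<le> s \<Longrightarrow> s \<le> t \<Longrightarrow> norm (L s - L r) \<le> A s - A r"
  shows "total_variation L t \<le> A t - A 0"
  unfolding total_variation_def
  by (rule cSup_least[OF variation_sums_nonempty]) (rule variation_sums_le[OF assms])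

lemma total_variation_add_increment_le:
  assumes bdd: "bdd_above (variation_sums {0..t} L)" and st: "0 \<le> s" "s \<le> t"
  shows "total_variation L s + norm (L t - L s) \<le> total_variation L t"
proof -
  have "total_variation L s \<le> total_variation L t - norm (L t - L s)"
    unfolding total_variation_def
  proof (rule cSup_least[OF variation_sums_nonempty])
    fix v assume "v \<in> variation_sums {0..s} L"
    then obtain ps where ps: "sorted ps" "set ps \<subseteq> {0..s}"
      and v: "v = (\<Sum>i<length ps - 1. norm (L (ps ! Suc i) - L (ps ! i)))"
      by (auto simp: variation_sums_def)
    define qs where "qs = ps @ [s, t]"
    have "v \<le> (\<Sum>i<length ps. norm (L (qs ! Suc i) - L (qs ! i)))"
    proof -
      have "v = (\<Sum>i<length ps - 1. norm (L (qs ! Suc i) - L (qs ! i)))"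
        unfolding v by (intro sum.cong) (auto simp: qs_def nth_append)
      also have "\<dots> \<le> (\<Sum>i<length ps. norm (L (qs ! Suc i) - L (qs ! i)))"
        by (rule sum_mono2) auto
      finally show ?thesis .
    qed
    then have "v + norm (L t - L s) \<le> (\<Sum>i<length qs - 1. norm (L (qs ! Suc i) - L (qs ! i)))"
      by (simp add: qs_def nth_append)
    also have "\<dots> \<in> variation_sums {0..t} L"
    proof -
      have "sorted qs" "set qs \<subseteq> {0..t}" using ps st by (auto simp: qs_def sorted_append)
      then show ?thesis by (auto simp: variation_sums_def)
    qed
    then have "(\<Sum>i<length qs - 1. norm (L (qs ! Suc i) - L (qs ! i))) \<le> Sup (variation_sums {0..t} L)"
      using bdd by (rule cSup_upper)
    finally show "v \<le> Sup (variation_sums {0..t} L) - norm (L t - L s)" by simp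
  qed
  then show ?thesis by simp
qed

lemma total_variation_nonpos:
  assumes "t \<le> 0"
  shows "total_variation L t = 0"
proof -
  have "v = 0" if v: "v \<in> variation_sums {0..t} L" for v
  proof -
    obtain ps where ps: "set ps \<subseteq> {0..t}"
      and v: "v = (\<Sum>i<length ps - 1. norm (L (ps ! Suc i) - L (ps ! i)))"
      using v by (auto simp: variation_sums_def)
    have "ps ! i = 0" if "i < length ps" for i
      using ps assms nth_mem[OF that] by fastforce
    then show ?thesis by (simp add: v)
  qed
  then have "variation_sums {0..t} L = {0}" using variation_sums_nonempty[of "{0..t}" L] by blast
  then show ?thesis by (simp add: total_variation_def)
qed

text \<open>
  A partition of \<open>[0, t]\<close> may use the time \<open>0\<close>, which the open intervals exclude; moving \<open>0\<close> slightly
  to the right changes its sum by little.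
\<close>

lemma bounded_variation_closed:
  fixes L :: "real \<Rightarrow> 'e::real_normed_vector"
  assumes cont: "continuous_on {0..} L" and bv: "has_bounded_variation {0<..<T} L" and t: "t < T"
  shows "bdd_above (variation_sums {0..t} L)"
proof -
  obtain B where B: "\<And>v. v \<in> variation_sums {0<..<T} L \<Longrightarrow> v \<le> B"
    using bv unfolding has_bounded_variation_def bdd_above_def by blast
  have "v \<le> B" if v: "v \<in> variation_sums {0..t} L" for v
  proof -
    obtain ps where ps: "sorted ps" "set ps \<subseteq> {0..t}"
      and v: "v = (\<Sum>i<length ps - 1. norm (L (ps ! Suc i) - L (ps ! i)))"
      using v by (auto simp: variation_sums_def)
    have lim: "((\<lambda>\<eta>. L (max \<eta> p)) \<longlongrightarrow> L p) (at_right 0)" if "p \<ge> 0" for p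
    proof (rule continuous_on_tendsto_compose[OF cont])
      show "((\<lambda>\<eta>. max \<eta> p) \<longlongrightarrow> p) (at_right 0)" using that by (auto intro!: tendsto_eq_intros)
      show "\<forall>\<^sub>F \<eta> in at_right 0. max \<eta> p \<in> {0..}"
        using eventually_at_right_less[of 0] by eventually_elim auto
    qed (use that in simp)
    show ?thesis
    proof (rule tendsto_upperbound[where F = "at_right 0"])
      show "((\<lambda>\<eta>. \<Sum>i<length ps - 1. norm (L (max \<eta> (ps ! Suc i)) - L (max \<eta> (ps ! i)))) \<longlongrightarrow> v) (at_right 0)"
        unfolding v
      proof (intro tendsto_intros lim)
        fix i assume "i \<in> {..<length ps - 1}"
        then have i: "Suc i < length ps" "i < length ps" by auto
        show "0 \<le> ps ! Suc i" "0 \<le> ps ! i"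
          using subsetD[OF ps(2) nth_mem[OF i(1)]] subsetD[OF ps(2) nth_mem[OF i(2)]] by auto
      qed
      have "T > 0 \<or> ps = []" using t ps(2) by (cases ps) auto
      then show "\<forall>\<^sub>F \<eta> in at_right 0. (\<Sum>i<length ps - 1. norm (L (max \<eta> (ps ! Suc i)) - L (max \<eta> (ps ! i)))) \<le> B"
      proof
        assume "T > 0"
        have "\<forall>\<^sub>F \<eta> in at_right (0::real). \<eta> < T"
          using \<open>T > 0\<close> by (rule order_tendstoD(2)[OF tendsto_ident_at])
        with eventually_at_right_less[of 0] show ?thesis
        proof eventually_elim
          case (elim \<eta>)
          have "(\<Sum>i<length (map (max \<eta>) ps) - 1. norm (L (map (max \<eta>) ps ! Suc i) - L (map (max \<eta>) ps ! i)))
              \<in> variation_sums {0<..<T} L"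
          proof -
            have "sorted (map (max \<eta>) ps)"
              unfolding sorted_map by (rule sorted_wrt_mono_rel[OF _ ps(1)]) (rule max.mono, auto)
            moreover have "set (map (max \<eta>) ps) \<subseteq> {0<..<T}" using ps(2) elim t by auto
            ultimately show ?thesis unfolding variation_sums_def by blast
          qed
          from B[OF this] show ?case by simp
        qed
      next
        assume "ps = []"
        moreover have "0 \<in> variation_sums {0<..<T} L"
          by (auto simp: variation_sums_def intro!: exI[of _ "[]"])
        ultimately show ?thesis using B by simp
      qed
    qed simp
  qed
  then show ?thesis by (rule bdd_aboveI)
qed

context
  fixes L :: "real \<Rightarrow> 'e::real_normed_vector"
  assumes cont: "continuous_on {0..} L"
    and bdd: "\<And>t. t \<ge> 0 \<Longrightarrow> bdd_above (variation_sums {0..t} L)"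
begin

lemma norm_increment_le_total_variation:
  "0 \<le> s \<Longrightarrow> s \<le> t \<Longrightarrow> norm (L t - L s) \<le> total_variation L t - total_variation L s"
  using total_variation_add_increment_le[OF bdd, of t s] by simp

lemma total_variation_mono:
  assumes "s \<le> t" shows "total_variation L s \<le> total_variation L t"
proof -
  have mono: "total_variation L r \<le> total_variation L t" if "0 \<le> r" "r \<le> t" for r
    using norm_increment_le_total_variation[OF that] norm_ge_zero[of "L t - L r"] by linarith
  show ?thesis
  proof (cases "0 \<le> s")
    case False
    then show ?thesis
      using mono[of 0] total_variation_nonpos[of s L] total_variation_nonpos[of 0 L]
        total_variation_nonpos[of t L] by (cases "0 \<le> t") auto
  qed (use mono assms in simp)
qed

text \<open>
  If the total variation \<open>A\<close> jumped by \<open>j\<close> to the right of \<open>t\<close>, then lowering it by \<open>j\<close> after \<open>t\<close> would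
  leave a function that still dominates the increments of the continuous function \<open>L\<close>, contrary to
  the minimality of \<open>A\<close>.
\<close>

lemma total_variation_right_continuous: "continuous (at_right t) (total_variation L)"
proof (cases "t < 0")
  case True
  have "\<forall>\<^sub>F r in at_right t. total_variation L r = 0"
    unfolding eventually_at_right_field using True by (intro exI[of _ 0]) (auto intro: total_variation_nonpos)
  then show ?thesis
    using total_variation_nonpos[of t L] True by (simp add: continuous_within tendsto_eventually)
next
  case False
  define A where "A = total_variation L"
  note inc = norm_increment_le_total_variation[folded A_def]
  note mono = total_variation_mono[folded A_def]
  have "\<exists>u>t. A u < A t + j" if j: "j > 0" for j
  proof (rule ccontr)
    assume "\<not> ?thesis"
    then have jump: "A t + j \<le> A u" if "u > t" for u using that by force
    define A' where "A' u = (if u \<le> t then A u else A u - j)" for u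
    have after: "norm (L u - L t) \<le> A u - (A t + j)" if u: "u > t" for u
    proof (rule tendsto_upperbound[where F = "at_right t"])
      have "(L \<longlongrightarrow> L t) (at t within {0..})" using cont False by (auto simp: continuous_on_def)
      then have "(L \<longlongrightarrow> L t) (at_right t)" by (rule tendsto_within_subset) (use False in auto)
      then show "((\<lambda>r. norm (L u - L r)) \<longlongrightarrow> norm (L u - L t)) (at_right t)" by (intro tendsto_intros)
      show "\<forall>\<^sub>F r in at_right t. norm (L u - L r) \<le> A u - (A t + j)"
        unfolding eventually_at_right_field
      proof (intro exI[of _ u] conjI allI impI)
        fix r assume "t < r" "r < u"
        then show "norm (L u - L r) \<le> A u - (A t + j)"
          using inc[of r u] jump[of r] False by simp
      qed (rule u)
    qed simp
    have "total_variation L (t + 1) \<le> A' (t + 1) - A' 0"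
    proof (rule total_variation_le)
      fix r s assume rs: "0 \<le> r" "r \<le> s" "s \<le> t + 1"
      show "norm (L s - L r) \<le> A' s - A' r"
      proof (cases "r \<le> t \<and> t < s")
        case True
        then show ?thesis
          using after[of s] inc[of r t] rs norm_triangle_ineq[of "L s - L t" "L t - L r"]
          by (simp add: A'_def)
      next
        case False
        then show ?thesis using inc[of r s] rs by (auto simp: A'_def)
      qed
    qed (use False in simp)
    moreover have "A 0 = 0" by (simp add: A_def total_variation_nonpos)
    ultimately show False using j False by (simp add: A'_def A_def[symmetric])
  qed
  then have ev: "\<forall>\<^sub>F r in at_right t. A r < A t + j" if "j > 0" for j
    unfolding eventually_at_right_field using that mono by (metis less_imp_le order_le_less_trans)
  have "(A \<longlongrightarrow> A t) (at_right t)"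
  proof (rule order_tendstoI)
    fix a assume a: "a < A t"
    have "\<forall>\<^sub>F r in at_right t. t < r" by (rule eventually_at_right_less)
    then show "\<forall>\<^sub>F r in at_right t. a < A r"
      by eventually_elim (use a mono in \<open>meson less_imp_le order_less_le_trans\<close>)
  next
    fix a assume "A t < a"
    then show "\<forall>\<^sub>F r in at_right t. A r < a" using ev[of "a - A t"] by simp
  qed
  then show ?thesis by (simp add: continuous_within A_def)
qed

end

section \<open>Pushing along the normal as a Stieltjes integral\<close>

lemma norm_integral_indicator_le:
  fixes f :: "'a::euclidean_space \<Rightarrow> 'e::{banach, second_countable_topology}"
  assumes E: "E \<in> sets M" "emeasure M E < \<infinity>"
    and bound: "\<And>r. r \<in> E \<Longrightarrow> norm (f r) \<le> \<epsilon>"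
  shows "norm (LINT r|M. indicator E r *\<^sub>R f r) \<le> \<epsilon> * measure M E"
proof (cases "integrable M (\<lambda>r. indicator E r *\<^sub>R f r)")
  case True
  have "norm (LINT r|M. indicator E r *\<^sub>R f r) \<le> (LINT r|M. \<epsilon> * indicator E r)"
  proof (rule Bochner_Integration.integral_norm_bound_integral[OF True])
    show "integrable M (\<lambda>r. \<epsilon> * indicator E r :: real)"
      using E by (intro integrable_mult_right integrable_real_indicator) auto
    show "norm (indicator E r *\<^sub>R f r) \<le> \<epsilon> * indicator E r" if "r \<in> space M" for r
      using bound[of r] by (auto simp: indicator_def)
  qed
  also have "\<dots> = \<epsilon> * measure M E" using E by (simp add: sets.Int_space_eq2)
  finally show ?thesis .
next
  case False
  show ?thesis
  proof (cases "E = {}")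
    case ne: False
    then obtain r where "r \<in> E" by blast
    then have "\<epsilon> \<ge> 0" using bound[of r] norm_ge_zero order_trans by blast
    then show ?thesis using False by (simp add: not_integrable_integral_eq)
  qed simp
qed

lemma indicator_integral_eq_measure:
  assumes "{s \<in> I. x s \<in> B} \<in> sets M"
  shows "(LINT s:I|M. indicator B (x s)) = measure M {s \<in> I. x s \<in> B}"
proof -
  have "(LINT s:I|M. indicator B (x s)) = (LINT s|M. indicator {s \<in> I. x s \<in> B} s)"
    unfolding set_lebesgue_integral_def
    by (intro Bochner_Integration.integral_cong) (auto simp: indicator_def)
  also have "\<dots> = measure M {s \<in> I. x s \<in> B}" using assms by (simp add: sets.Int_space_eq2)
  finally show ?thesis .
qed

context reflecting_domain
begin

context
  fixes x :: "real \<Rightarrow> 'e" and A :: "real \<Rightarrow> real"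
  assumes x: "continuous_on {0..} x"
    and mono: "mono A"
    and right: "\<forall>t. continuous (at_right t) A"
    and nonpos: "\<forall>t\<le>0. A t = 0"
begin

abbreviation visits :: "real set \<Rightarrow> real set" where
  "visits I \<equiv> {r \<in> I. x r \<in> frontier D}"

lemma closed_visits: "closed (visits {0..})"
proof -
  have "visits {0..} = {0..} \<inter> x -` frontier D" by auto
  then show ?thesis by (simp only:) (rule continuous_closed_preimage[OF x], auto)
qed

lemma visits_measurable:
  assumes "I \<in> sets borel" "I \<subseteq> {0..}"
  shows "visits I \<in> sets (interval_measure A)"
proof -
  have "visits I = I \<inter> visits {0..}" using assms(2) by auto
  then show ?thesis using assms(1) closed_visits by (simp add: borel_closed)
qed

lemma emeasure_bounded_finite:
  assumes "I \<in> sets borel" "I \<subseteq> {0..t}"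
  shows "emeasure (interval_measure A) I < \<infinity>"
proof -
  have "emeasure (interval_measure A) I \<le> emeasure (interval_measure A) {-1<..max t 0}"
    using assms by (intro emeasure_mono) auto
  also have "\<dots> < \<infinity>" by (simp add: emeasure_interval_measure_Ioc monoD[OF mono] right)
  finally show ?thesis .
qed

text \<open>
  The measure is given on half-open intervals; the part of \<open>(-1, t]\<close> below \<open>0\<close> is null because \<open>A\<close>
  vanishes there.
\<close>

lemma measure_from_0:
  assumes t: "t \<ge> 0" shows "measure (interval_measure A) {0..t} = A t"
proof -
  let ?M = "interval_measure A"
  have "emeasure ?M {-1<..<0} \<le> emeasure ?M {-1<..0}" by (intro emeasure_mono) auto
  also have "\<dots> = 0" by (simp add: emeasure_interval_measure_Ioc monoD[OF mono] right nonpos)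
  finally have "emeasure ?M {-1<..<0} = 0" by simp
  moreover have "{-1<..t} = {-1<..<0} \<union> {0..t}" using t by auto
  moreover have "emeasure ?M ({0..t} \<union> {-1<..<0}) = emeasure ?M {0..t}"
    if "emeasure ?M {-1<..<0} = 0"
    using that by (intro emeasure_Un_null_set) (auto simp: null_sets_def)
  ultimately have "emeasure ?M {-1<..t} = emeasure ?M {0..t}" by (simp only: Un_commute)
  then have "measure ?M {0..t} = measure ?M {-1<..t}" by (simp add: measure_def)
  also have "\<dots> = A t" using t by (simp add: measure_interval_measure_Ioc monoD[OF mono] right nonpos)
  finally show ?thesis .
qed

lemma normal_integrable:
  assumes "I \<in> sets borel" "I \<subseteq> {0..t}"
  shows "integrable (interval_measure A) (\<lambda>r. indicator (visits I) r *\<^sub>R n (x r))"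
proof -
  have I0: "I \<subseteq> {0..}" using assms(2) by auto
  define f where "f r = indicator (visits {0..}) r *\<^sub>R n (x r)" for r
  have "continuous_on (visits {0..}) (\<lambda>r. n (x r))"
    by (rule continuous_on_compose2[OF continuous_normal]) (auto intro: continuous_on_subset[OF x])
  then have meas: "f \<in> borel_measurable borel"
    unfolding f_def by (intro borel_measurable_continuous_on_indicator borel_closed closed_visits)
  have "integrable (interval_measure A) (\<lambda>r. indicator (visits I) r *\<^sub>R f r)"
  proof (rule integrableI_bounded_set_indicator[where B = 1])
    show "visits I \<in> sets (interval_measure A)" by (rule visits_measurable[OF assms(1) I0])
    then show "emeasure (interval_measure A) (visits I) < \<infinity>"
      using assms(2) by (intro emeasure_bounded_finite[of _ t]) auto
    show "f \<in> borel_measurable (interval_measure A)" using meas by simp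
    show "AE r in interval_measure A. r \<in> visits I \<longrightarrow> norm (f r) \<le> 1"
      by (rule AE_I2) (auto simp: f_def indicator_def unit_normal)
  qed
  moreover have "indicator (visits I) r *\<^sub>R f r = indicator (visits I) r *\<^sub>R n (x r)" for r
    using I0 by (auto simp: f_def indicator_def)
  ultimately show ?thesis by simp
qed

text \<open>
  While the visited normals are within \<open>\<epsilon>\<close> of \<open>v\<close>, the integral of \<open>n(x)\<close> differs from \<open>v\<close> times the
  mass of the visits by at most \<open>\<epsilon>\<close> times that mass, which by hypothesis is the increment of \<open>A\<close>.
\<close>

lemma stieltjes_pushed_along:
  assumes charge: "\<forall>t\<ge>0. A t = measure (interval_measure A) (visits {0..t})"
  defines "H \<equiv> \<lambda>t. LINT r|interval_measure A. indicator (visits {0..t}) r *\<^sub>R n (x r)"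
  shows "pushed_along (frontier D) n x H A" and "H 0 = 0"
proof -
  let ?M = "interval_measure A"
  have vm: "visits I \<in> sets ?M" "emeasure ?M (visits I) < \<infinity>"
    if "I \<in> sets borel" "I \<subseteq> {0..t}" for I t
  proof -
    show "visits I \<in> sets ?M" using that by (intro visits_measurable) auto
    then show "emeasure ?M (visits I) < \<infinity>" using that by (intro emeasure_bounded_finite[of _ t]) auto
  qed
  have "norm (H 0) \<le> 1 * measure ?M (visits {0..0})"
    unfolding H_def by (rule norm_integral_indicator_le) (use vm[of "{0..0}" 0] unit_normal in auto)
  also have "1 * measure ?M (visits {0..0}) = 0" using charge nonpos by (metis mult_1 order_refl)
  finally show "H 0 = 0" by simp
  show "pushed_along (frontier D) n x H A"
    unfolding pushed_along_def
  proof (intro allI impI)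
    fix s t :: real and v \<epsilon>
    assume st: "0 \<le> s" "s \<le> t" and "0 \<le> \<epsilon>"
      and near: "\<forall>r\<in>{s..t}. x r \<in> frontier D \<longrightarrow> norm (n (x r) - v) \<le> \<epsilon>"
    define E where "E = visits {s<..t}"
    have sub: "{s<..t} \<subseteq> {0..t}" using st by auto
    have E: "E \<in> sets ?M" "emeasure ?M E < \<infinity>"
      using vm[OF _ sub] by (auto simp: E_def)
    have split: "visits {0..t} = visits {0..s} \<union> E" "visits {0..s} \<inter> E = {}"
      using st by (auto simp: E_def)
    have "measure ?M (visits {0..t}) = measure ?M (visits {0..s}) + measure ?M E"
      unfolding split(1) using vm[of "{0..s}" s] E split(2) by (intro measure_Union) auto
    then have mE: "measure ?M E = A t - A s" using charge st by simp
    have int: "integrable ?M (\<lambda>r. indicator (visits {0..t}) r *\<^sub>R n (x r))"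
      "integrable ?M (\<lambda>r. indicator (visits {0..s}) r *\<^sub>R n (x r))"
      using normal_integrable[of "{0..t}" t] normal_integrable[of "{0..s}" s] by auto
    have intv: "integrable ?M (\<lambda>r. indicator E r *\<^sub>R v)"
      using E by (intro integrable_scaleR_left integrable_real_indicator) auto
    have "(LINT r|?M. indicator E r *\<^sub>R v) = measure ?M E *\<^sub>R v"
      using E by (subst integral_scaleR_left) (auto simp: sets.Int_space_eq2 intro!: integrable_real_indicator)
    then have "H t - H s - (A t - A s) *\<^sub>R v =
        (LINT r|?M. indicator (visits {0..t}) r *\<^sub>R n (x r) - indicator (visits {0..s}) r *\<^sub>R n (x r)
           - indicator E r *\<^sub>R v)"
      unfolding H_def using int intv mE by simp
    also have "\<dots> = (LINT r|?M. indicator E r *\<^sub>R (n (x r) - v))"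
      using split by (intro Bochner_Integration.integral_cong)
        (auto simp: indicator_def scaleR_diff_right)
    also have "norm \<dots> \<le> \<epsilon> * measure ?M E"
      by (rule norm_integral_indicator_le[OF E]) (use near in \<open>auto simp: E_def\<close>)
    finally show "norm (H t - H s - (A t - A s) *\<^sub>R v) \<le> \<epsilon> * (A t - A s)" by (simp add: mE)
  qed
qed

text \<open>
  The times off the boundary form an open set, a countable union of intervals during which the clock
  stands still.
\<close>

lemma measure_visits:
  assumes push: "pushed_along (frontier D) n x L A" and t: "t \<ge> 0"
  shows "measure (interval_measure A) (visits {0..t}) = A t"
proof -
  let ?M = "interval_measure A"
  define S where "S = {0<..} \<inter> x -` (- frontier D)"
  have "open S"
    unfolding S_def
    by (intro continuous_open_preimage continuous_on_subset[OF x]) auto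
  define P where "P = {(a, b). a \<in> \<rat> \<and> b \<in> \<rat> \<and> 0 \<le> a \<and> a \<le> b \<and> {a..b} \<subseteq> S}"
  have "S \<subseteq> (\<Union>(a, b)\<in>P. {a<..b})"
  proof
    fix r assume r: "r \<in> S"
    then obtain \<delta> where \<delta>: "\<delta> > 0" "ball r \<delta> \<subseteq> S" using \<open>open S\<close> openE by blast
    obtain a where a: "a \<in> \<rat>" "max 0 (r - \<delta>) < a" "a < r"
      using Rats_dense_in_real[of "max 0 (r - \<delta>)" r] r \<delta>(1) by (auto simp: S_def)
    obtain b where b: "b \<in> \<rat>" "r < b" "b < r + \<delta>" using Rats_dense_in_real[of r "r + \<delta>"] \<delta>(1) by auto
    have "{a..b} \<subseteq> ball r \<delta>" using a b by (auto simp: dist_real_def)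
    then have "(a, b) \<in> P" using a b \<delta>(2) by (auto simp: P_def)
    then show "r \<in> (\<Union>(a, b)\<in>P. {a<..b})" by (rule UN_I) (use a b in auto)
  qed
  moreover have "(\<Union>(a, b)\<in>P. {a<..b}) \<in> null_sets ?M"
  proof (rule null_sets_UN')
    have "P \<subseteq> \<rat> \<times> \<rat>" by (auto simp: P_def)
    then show "countable P" by (rule countable_subset) (intro countable_SIGMA countable_rat)
    fix p assume "p \<in> P"
    then obtain a b where p: "p = (a, b)" "0 \<le> a" "a \<le> b" "{a..b} \<subseteq> S" by (auto simp: P_def)
    have "A b = A a"
      by (rule pushed_along_idle(1)[OF push p(2,3)]) (use p(4) in \<open>auto simp: S_def\<close>)
    then show "(case p of (a, b) \<Rightarrow> {a<..b}) \<in> null_sets ?M"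
      using p by (simp add: null_sets_def emeasure_interval_measure_Ioc monoD[OF mono] right)
  qed
  moreover have "S \<in> sets ?M" using \<open>open S\<close> by simp
  ultimately have S: "S \<in> null_sets ?M" using null_sets_subset by blast
  have "{0} \<in> null_sets ?M"
  proof -
    have "emeasure ?M {0} \<le> emeasure ?M {-1<..0}" by (intro emeasure_mono) auto
    also have "\<dots> = 0" by (simp add: emeasure_interval_measure_Ioc monoD[OF mono] right nonpos)
    finally show ?thesis by (simp add: null_sets_def)
  qed
  with S have N: "{0} \<union> S \<in> null_sets ?M" by (rule null_sets.Un[rotated])
  have "emeasure ?M (visits {0..t}) = emeasure ?M {0..t}"
  proof (rule emeasure_eq_AE)
    show "AE r in ?M. (r \<in> visits {0..t}) = (r \<in> {0..t})"
      by (rule AE_I'[OF N]) (auto simp: S_def)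
    show "visits {0..t} \<in> sets ?M" by (rule visits_measurable) auto
  qed simp
  then show ?thesis using measure_from_0[OF t] by (simp add: measure_def)
qed

end

text \<open>
  On short intervals both pushes are the increment of the clock times the same visited normal, up to
  a small relative error, and these errors sum to nothing.
\<close>

lemma pushed_along_unique:
  assumes x: "continuous_on {0..} x"
    and L: "pushed_along (frontier D) n x L A" and L': "pushed_along (frontier D) n x L' A"
    and init: "L 0 = L' 0" and t: "t \<ge> 0"
  shows "L t = L' t"
proof -
  have xt: "continuous_on {0..t} x" by (rule continuous_on_subset[OF x]) auto
  have "L t - L' t = L 0 - L' 0"
  proof (rule constant_of_local[OF t, where k = A])
    fix \<epsilon> :: real assume "\<epsilon> > 0"
    then have eps: "\<epsilon> / 2 > 0" by simp
    obtain \<delta> where \<delta>: "\<delta> > 0"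
      "\<And>r r'. r \<in> {0..t} \<Longrightarrow> r' \<in> {0..t} \<Longrightarrow> x r \<in> frontier D \<Longrightarrow> x r' \<in> frontier D \<Longrightarrow>
        \<bar>r - r'\<bar> < \<delta> \<Longrightarrow> norm (n (x r) - n (x r')) \<le> \<epsilon> / 2"
      using normal_uniformly_continuous[OF xt eps] by metis
    show "\<exists>\<delta>>0. \<forall>s u. 0 \<le> s \<longrightarrow> s \<le> u \<longrightarrow> u \<le> t \<longrightarrow> u - s < \<delta> \<longrightarrow>
        norm (L u - L' u - (L s - L' s)) \<le> \<epsilon> * (A u - A s)"
    proof (intro exI[of _ \<delta>] conjI allI impI)
      fix s u assume su: "0 \<le> s" "s \<le> u" "u \<le> t" "u - s < \<delta>"
      show "norm (L u - L' u - (L s - L' s)) \<le> \<epsilon> * (A u - A s)"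
      proof (cases "\<exists>r\<in>{s..u}. x r \<in> frontier D")
        case True
        then obtain r where r: "r \<in> {s..u}" "x r \<in> frontier D" by blast
        have near: "norm (n (x q) - n (x r)) \<le> \<epsilon> / 2" if "s \<le> q" "q \<le> u" "x q \<in> frontier D" for q
          using that r su by (intro \<delta>(2)) auto
        have "L u - L' u - (L s - L' s) = (L u - L s - (A u - A s) *\<^sub>R n (x r)) - (L' u - L' s - (A u - A s) *\<^sub>R n (x r))"
          by simp
        also have "norm \<dots> \<le> norm (L u - L s - (A u - A s) *\<^sub>R n (x r)) + norm (L' u - L' s - (A u - A s) *\<^sub>R n (x r))"
          by (rule norm_triangle_ineq4)
        also have "\<dots> \<le> \<epsilon> / 2 * (A u - A s) + \<epsilon> / 2 * (A u - A s)"
          using near su eps by (intro add_mono pushed_alongD[OF L] pushed_alongD[OF L']) auto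
        finally show ?thesis by simp
      next
        case False
        then show ?thesis
          using pushed_along_idle[OF L, of s u] pushed_along_idle[OF L', of s u] su by auto
      qed
    qed (rule \<delta>(1))
  qed
  then show ?thesis using init by simp
qed

text \<open>
  Over a short interval \<open>dL\<close> is \<open>dA\<close> times a nearly constant unit vector, so no length is lost and the
  clock is the total variation.
\<close>

lemma total_variation_pushed:
  assumes x: "continuous_on {0..} x" and push: "pushed_along (frontier D) n x L A"
    and A0: "A 0 = 0" and t: "t \<ge> 0"
  shows "total_variation L t = A t" and "bdd_above (variation_sums {0..t} L)"
proof -
  have dom: "norm (L s - L r) \<le> A s - A r" if "0 \<le> r" "r \<le> s" for r s
    by (rule pushed_along_norm_le[OF push that])
  have bdd: "bdd_above (variation_sums {0..u} L)" if "u \<ge> 0" for u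
    by (rule bdd_aboveI) (rule variation_sums_le[OF that dom])
  then show "bdd_above (variation_sums {0..t} L)" using t .
  have "A t - A 0 \<le> total_variation L t - total_variation L 0"
  proof (rule increments_le_of_local[OF t, where k = A])
    fix \<epsilon> :: real assume eps: "\<epsilon> > 0"
    have xt: "continuous_on {0..t} x" by (rule continuous_on_subset[OF x]) auto
    obtain \<delta> where \<delta>: "\<delta> > 0" "\<And>s u. 0 \<le> s \<Longrightarrow> s \<le> u \<Longrightarrow> u \<le> t \<Longrightarrow> u - s < \<delta> \<Longrightarrow>
       A u = A s \<and> L u = L s \<or>
       (\<exists>r\<in>{s..u}. x r \<in> frontier D \<and> norm (L u - L s - (A u - A s) *\<^sub>R n (x r)) \<le> \<epsilon> * (A u - A s))"
      using pushed_along_local[OF xt order_refl push eps] by metis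
    show "\<exists>\<delta>>0. \<forall>s u. 0 \<le> s \<longrightarrow> s \<le> u \<longrightarrow> u \<le> t \<longrightarrow> u - s < \<delta> \<longrightarrow>
        A u - A s \<le> total_variation L u - total_variation L s + \<epsilon> * (A u - A s)"
    proof (intro exI[of _ \<delta>] conjI allI impI)
      fix s u assume su: "0 \<le> s" "s \<le> u" "u \<le> t" "u - s < \<delta>"
      have tv: "norm (L u - L s) \<le> total_variation L u - total_variation L s"
        using total_variation_add_increment_le[OF bdd, of u s] su by simp
      from \<delta>(2)[OF su] show "A u - A s \<le> total_variation L u - total_variation L s + \<epsilon> * (A u - A s)"
      proof
        assume "A u = A s \<and> L u = L s"
        then show ?thesis using tv by simp
      next
        assume "\<exists>r\<in>{s..u}. x r \<in> frontier D \<and> norm (L u - L s - (A u - A s) *\<^sub>R n (x r)) \<le> \<epsilon> * (A u - A s)"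
        then obtain r where r: "x r \<in> frontier D"
          "norm (L u - L s - (A u - A s) *\<^sub>R n (x r)) \<le> \<epsilon> * (A u - A s)" by blast
        have "A u - A s = norm ((A u - A s) *\<^sub>R n (x r))"
          using unit_normal[OF r(1)] pushed_along_mono[OF push su(1,2)] by simp
        also have "\<dots> \<le> norm (L u - L s) + norm (L u - L s - (A u - A s) *\<^sub>R n (x r))"
          using norm_triangle_ineq4[of "L u - L s" "L u - L s - (A u - A s) *\<^sub>R n (x r)"] by simp
        finally show ?thesis using tv r(2) by simp
      qed
    qed (rule \<delta>(1))
  qed
  moreover have "total_variation L t \<le> A t - A 0" by (rule total_variation_le[OF t dom])
  ultimately show "total_variation L t = A t" using A0 by (simp add: total_variation_nonpos)
qed

theorem extended_skorohod_of_push_solution: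
  assumes sol: "push_solution w D n x L A"
  shows "extended_skorohod w D n x"
proof -
  have x: "continuous_on {0..} x" and cD: "\<forall>t\<ge>0. x t \<in> closure D" and L: "continuous_on {0..} L"
    and eq: "\<forall>t\<ge>0. x t = w t + integral {0..t} L + L t" and init: "L 0 = 0" "A 0 = 0"
    and push: "pushed_along (frontier D) n x L A"
    using sol by (auto simp: push_solution_def)
  note TV = total_variation_pushed[OF x push init(2)]
  define B where "B = total_variation L"
  have BA: "B t = A t" if "t \<ge> 0" for t using TV(1)[OF that] by (simp add: B_def)
  have pushB: "pushed_along (frontier D) n x L B"
    using push BA unfolding pushed_along_def by simp
  have B: "mono B" "\<forall>t. continuous (at_right t) B" "\<forall>t\<le>0. B t = 0"
    unfolding B_def
    by (simp_all add: total_variation_mono[OF L TV(2)] total_variation_right_continuous[OF L TV(2)]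
        total_variation_nonpos monoI)
  have charge: "\<forall>t\<ge>0. B t = measure (interval_measure B) {r \<in> {0..t}. x r \<in> frontier D}"
    using measure_visits[OF x B pushB] by simp
  note H = stieltjes_pushed_along[OF x B charge]
  have M: "variation_measure L = interval_measure B" by (simp add: variation_measure_def B_def)
  have "has_bounded_variation {0<..<T} L" if "T > 0" for T
  proof -
    have "variation_sums {0<..<T} L \<subseteq> variation_sums {0..T} L" by (rule variation_sums_mono) auto
    then show ?thesis
      unfolding has_bounded_variation_def using TV(2)[of T] that by (meson bdd_above_mono less_imp_le)
  qed
  moreover have "total_variation L t = (LINT s:{0..t}|variation_measure L. indicator (frontier D) (x s))"
    if t: "t \<ge> 0" for t
  proof -
    have "{s \<in> {0..t}. x s \<in> frontier D} \<in> sets (interval_measure B)"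
      by (rule visits_measurable[OF x B]) auto
    then show ?thesis
      unfolding M using charge t by (subst indicator_integral_eq_measure) (auto simp: B_def)
  qed
  moreover have "L t = (LINT s:{s \<in> {0..t}. x s \<in> frontier D}|variation_measure L. n (x s))"
    if t: "t \<ge> 0" for t
    unfolding M set_lebesgue_integral_def
    by (rule pushed_along_unique[OF x pushB H(1) _ t]) (simp only: H(2) init)
  ultimately show ?thesis
    unfolding extended_skorohod_def using x cD L eq by blast
qed

theorem push_solution_of_extended_skorohod:
  assumes "extended_skorohod w D n x"
  obtains L A where "push_solution w D n x L A" "\<forall>t. continuous (at_right t) A"
proof -
  obtain L where x: "continuous_on {0..} x" and cD: "\<forall>t\<ge>0. x t \<in> closure D"
    and L: "continuous_on {0..} L" and bv: "\<forall>T>0. has_bounded_variation {0<..<T} L"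
    and eq: "\<forall>t\<ge>0. x t = w t + integral {0..t} L + L t"
    and charge: "\<forall>t\<ge>0. total_variation L t =
         (LINT s:{0..t}|variation_measure L. indicator (frontier D) (x s))"
    and push: "\<forall>t\<ge>0. L t = (LINT s:{s\<in>{0..t}. x s \<in> frontier D}|variation_measure L. n (x s))"
    using assms unfolding extended_skorohod_def by blast
  have bdd: "bdd_above (variation_sums {0..t} L)" if "t \<ge> 0" for t
    using bounded_variation_closed[OF L, of "t + 1" t] bv that by simp
  define A where "A = total_variation L"
  have A: "mono A" "\<forall>t. continuous (at_right t) A" "\<forall>t\<le>0. A t = 0"
    unfolding A_def
    by (simp_all add: total_variation_mono[OF L bdd] total_variation_right_continuous[OF L bdd]
        total_variation_nonpos monoI)
  have M: "variation_measure L = interval_measure A" by (simp add: variation_measure_def A_def)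
  have "\<forall>t\<ge>0. A t = measure (interval_measure A) {s \<in> {0..t}. x s \<in> frontier D}"
  proof (intro allI impI)
    fix t :: real assume "t \<ge> 0"
    have "{s \<in> {0..t}. x s \<in> frontier D} \<in> sets (interval_measure A)"
      by (rule visits_measurable[OF x A]) auto
    then show "A t = measure (interval_measure A) {s \<in> {0..t}. x s \<in> frontier D}"
      using charge \<open>t \<ge> 0\<close> unfolding M by (simp add: A_def[symmetric] indicator_integral_eq_measure)
  qed
  note H = stieltjes_pushed_along[OF x A this]
  have LH: "L t = (LINT r|interval_measure A. indicator {s \<in> {0..t}. x s \<in> frontier D} r *\<^sub>R n (x r))"
    if "t \<ge> 0" for t
    using push that unfolding M set_lebesgue_integral_def by blast
  have "pushed_along (frontier D) n x L A"
    using H(1) unfolding pushed_along_def by (simp add: LH)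
  moreover have "L 0 = 0" using H(2) LH[of 0] by simp
  ultimately have "push_solution w D n x L A"
    unfolding push_solution_def using x cD L eq A(3) by simp
  then show thesis using A(2) by (rule that)
qed

theorem extended_skorohod_exists_unique:
  assumes w: "continuous_on {0..} w" and w0: "w 0 \<in> closure D"
  shows "\<exists>x. extended_skorohod w D n x \<and>
             (\<forall>y. extended_skorohod w D n y \<longrightarrow> (\<forall>t\<ge>0. y t = x t))"
proof -
  obtain x L A where "push_solution w D n x L A"
    by (rule push_solution_exists[OF w w0])
  then have x: "extended_skorohod w D n x" by (rule extended_skorohod_of_push_solution)
  have "y t = x t" if y: "extended_skorohod w D n y" and t: "t \<ge> 0" for y t
  proof -
    obtain L A where sx: "push_solution w D n x L A" "\<forall>t. continuous (at_right t) A"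
      by (rule push_solution_of_extended_skorohod[OF x])
    obtain L' A' where sy: "push_solution w D n y L' A'" "\<forall>t. continuous (at_right t) A'"
      by (rule push_solution_of_extended_skorohod[OF y])
    show ?thesis by (rule push_solution_unique[OF sy(1) sx(1) _ _ t]) (use sx sy in auto)
  qed
  with x show ?thesis by blast
qed

end

section \<open>The domain above a graph\<close>

lemma frontier_above_graph_subset:
  assumes "continuous_on UNIV f" and x: "x \<in> frontier (above_graph f)"
  shows "x = (fst x, f (fst x))"
proof -
  have cont: "continuous_on UNIV (\<lambda>x. f (fst x))"
    by (rule continuous_on_compose2[OF assms(1)]) (auto intro: continuous_intros)
  then have "open (above_graph f)" "closed {x. f (fst x) \<le> snd x}"
    unfolding above_graph_def
    by (intro open_Collect_less closed_Collect_le continuous_intros; simp)+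
  moreover from this(2) have "closure (above_graph f) \<subseteq> {x. f (fst x) \<le> snd x}"
    by (rule closure_minimal[rotated]) (auto simp: above_graph_def)
  ultimately have "frontier (above_graph f) \<subseteq> {x. f (fst x) \<le> snd x} - above_graph f"
    unfolding frontier_def by (auto simp: interior_open)
  with x have "f (fst x) = snd x" by (auto simp: above_graph_def)
  then show ?thesis by (simp add: prod_eq_iff)
qed

theorem theorem5p4:
  fixes f :: "real ^ 'm \<Rightarrow> real"
    and n :: "(real ^ 'm) \<times> real \<Rightarrow> (real ^ 'm) \<times> real"
    and w :: "real \<Rightarrow> (real ^ 'm) \<times> real"
    and D :: "((real ^ 'm) \<times> real) set"
    and \<alpha> :: real
  assumes D: "D = above_graph f"
    and f0: "f 0 = 0"
    and alpha: "0 < \<alpha>" "\<alpha> < 1"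
    and f_bound: "\<And>a. \<bar>f a\<bar> < 1 - \<alpha>"
    and normal: "inward_unit_normal f n"
    and normal_last: "\<And>x. x \<in> frontier D \<Longrightarrow> snd (n x) > \<alpha>"
    and cond_i: "\<exists>C0. \<forall>x\<in>frontier D. \<forall>x'\<in>closure D.
                   (x' - x) \<bullet> n x + C0 * (norm (x - x'))\<^sup>2 \<ge> 0"
    and cond_ii: "\<And>x k C. x \<in> frontier D \<Longrightarrow> C \<ge> 0 \<Longrightarrow>
                    (\<forall>x'\<in>closure D. (x' - x) \<bullet> k + C * (norm (x - x'))\<^sup>2 \<ge> 0) \<Longrightarrow>
                    \<exists>\<theta>\<ge>0. k = \<theta> *\<^sub>R n x"
    and w_cont: "continuous_on {0..} w"
    and w0: "w 0 \<in> D"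
  shows "\<exists>x. extended_skorohod w D n x \<and>
             (\<forall>y. extended_skorohod w D n y \<longrightarrow> (\<forall>t\<ge>0. y t = x t))"
proof -
  obtain C0 where C0: "\<And>x x'. x \<in> frontier D \<Longrightarrow> x' \<in> closure D \<Longrightarrow>
      (x' - x) \<bullet> n x + C0 * (norm (x - x'))\<^sup>2 \<ge> 0"
    using cond_i by blast
  have "isCont f a" for a
    using normal unfolding inward_unit_normal_def gderiv_def by (metis has_derivative_continuous)
  then have fr: "x = (fst x, f (fst x))" if "x \<in> frontier D" for x
    using that frontier_above_graph_subset[of f x] by (simp add: D continuous_at_imp_continuous_on)
  interpret reflecting_domain D n "max C0 0" 1 \<alpha> "(0, 1)"
  proof
    fix x assume x: "x \<in> frontier D"
    obtain g where "n (fst x, f (fst x)) = sgn (- g, 1)"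
      using normal unfolding inward_unit_normal_def by blast
    then have "n x = sgn (- g, 1)" using fr[OF x] by simp
    then show "norm (n x) = 1" by (simp add: norm_sgn zero_prod_def)
    show "x \<bullet> (0, 1) \<le> 1"
      using fr[OF x] f_bound[of "fst x"] alpha by (cases x) (auto simp: inner_prod_def)
    show "\<alpha> \<le> n x \<bullet> (0, 1)"
      using normal_last[OF x] by (simp add: inner_prod_def)
  next
    fix x x' assume "x \<in> frontier D" "x' \<in> closure D"
    then have "0 \<le> (x' - x) \<bullet> n x + C0 * (norm (x - x'))\<^sup>2" by (rule C0)
    also have "\<dots> \<le> (x' - x) \<bullet> n x + max C0 0 * (norm (x - x'))\<^sup>2"
      by (intro add_left_mono mult_right_mono) auto
    finally show "0 \<le> (x' - x) \<bullet> n x + max C0 0 * (norm (x - x'))\<^sup>2" .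
  qed (use cond_ii alpha in \<open>auto simp: norm_prod_def\<close>)
  show ?thesis
    using w0 closure_subset by (intro extended_skorohod_exists_unique[OF w_cont]) auto
qed

end
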